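(* Let $\mathfrak{g}$ be a Lie algebra over $\mathbb{C}$ of countable dimension equipped with a nondegenerate symmetric invariant bilinear form $\langle\cdot,\cdot\rangle$, and let $\hat{\mathfrak{g}}$ be the associated affine Lie algebra. Let $U_{1},\dots,U_{r}$ be irreducible $\mathfrak{g}$-modules and let $z_{1},\dots,z_{r}$ be distinct nonzero complex numbers. Then $U_{1}(z_{1})\otimes\cdots\otimes U_{r}(z_{r})$ is an irreducible $\hat{\mathfrak{g}}$-module.
   Context: $\hat{\mathfrak{g}}=\mathfrak{g}\otimes\mathbb{C}[t,t^{-1}]\oplus\mathbb{C}\mathbf{k}$ with $\mathbf{k}$ central and $[a\otimes t^{m},b\otimes t^{n}]=[a,b]\otimes t^{m+n}+m\langle a,b\rangle\delta_{m+n,0}\mathbf{k}$. For a $\mathfrak{g}$-module $U$ and $z\in\mathbb{C}\setminus\{0\}$, $U(z)$ is the $\hat{\mathfrak{g}}$-module with underlying space $U$, $\mathbf{k}$ acting as $0$ and $(a\otimes t^n)u=z^{n}(au)$ for $a\in\mathfrak{g}$, $n\in\mathbb{Z}$, $u\in U$. The tensor product is the tensor product $\hat{\mathfrak{g}}$-module. *)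

theory Defs
  imports
    Complex_Main
    "HOL-Library.Countable_Set"
    "HOL-Library.Poly_Mapping"
    "HOL-Library.Product_Plus"
    "HOL-Algebra.Algebraic_Closure_Type"
begin

text \<open>
  A complex Lie algebra is a whole type with an explicit complex scalar multiplication, in the
  style of \<^locale>\<open>vector_space\<close>. Modules carry an explicit carrier set, in the style of
  HOL-Algebra, because several of them are considered at once and because the tensor product is
  a quotient.
\<close>

locale lie_algebra = vector_space scale
  for scale :: "complex \<Rightarrow> 'g::ab_group_add \<Rightarrow> 'g" +
  fixes bracket :: "'g \<Rightarrow> 'g \<Rightarrow> 'g"
  assumes bracket_linear_left: "\<And>y. Vector_Spaces.linear scale scale (\<lambda>x. bracket x y)"
    and bracket_linear_right: "\<And>x. Vector_Spaces.linear scale scale (\<lambda>y. bracket x y)"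
    and bracket_self: "\<And>x. bracket x x = 0"
    and jacobi: "\<And>x y z. bracket x (bracket y z) + bracket y (bracket z x)
                         + bracket z (bracket x y) = 0"

text \<open>Countable means finite or countably infinite.\<close>

definition countable_dimension :: "(complex \<Rightarrow> 'g::ab_group_add \<Rightarrow> 'g) \<Rightarrow> bool" where
  "countable_dimension scale \<longleftrightarrow>
     (\<exists>B. countable B \<and> \<not> Modules.module.dependent scale B \<and> Modules.module.span scale B = UNIV)"

locale lie_algebra_form = lie_algebra scale bracket
  for scale :: "complex \<Rightarrow> 'g::ab_group_add \<Rightarrow> 'g" and bracket :: "'g \<Rightarrow> 'g \<Rightarrow> 'g" +
  fixes form :: "'g \<Rightarrow> 'g \<Rightarrow> complex"
  assumes form_linear_left: "\<And>y. Vector_Spaces.linear scale (*) (\<lambda>x. form x y)"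
    and form_linear_right: "\<And>x. Vector_Spaces.linear scale (*) (\<lambda>y. form x y)"
    and form_symmetric: "\<And>x y. form x y = form y x"
    and form_invariant: "\<And>x y z. form (bracket x y) z = form x (bracket y z)"
    and form_nondegenerate: "\<And>x. (\<And>y. form x y = 0) \<Longrightarrow> x = 0"


section \<open>Modules over a Lie algebra\<close>

text \<open>The inherited ring fields \<^term>\<open>monoid.mult\<close> and \<^term>\<open>one\<close> of a module record are
  meaningless, as for every HOL-Algebra module.\<close>

record ('g, 'u) lie_module = "(complex, 'u) module" +
  act :: "'g \<Rightarrow> 'u \<Rightarrow> 'u"

abbreviation complex_field :: "complex ring" where
  "complex_field \<equiv> ring_of_type_algebra"

locale lie_module = L: lie_algebra scale bracket + M: Module.module complex_field M
  for scale :: "complex \<Rightarrow> 'g::ab_group_add \<Rightarrow> 'g" and bracket :: "'g \<Rightarrow> 'g \<Rightarrow> 'g"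
    and M :: "('g, 'u) lie_module" (structure) +
  assumes act_closed: "\<And>x u. u \<in> carrier M \<Longrightarrow> act M x u \<in> carrier M"
    and act_add_left: "\<And>x y u. u \<in> carrier M \<Longrightarrow> act M (x + y) u = act M x u \<oplus> act M y u"
    and act_scale_left: "\<And>c x u. u \<in> carrier M \<Longrightarrow> act M (scale c x) u = c \<odot> act M x u"
    and act_add_right: "\<And>x u v. u \<in> carrier M \<Longrightarrow> v \<in> carrier M \<Longrightarrow>
          act M x (u \<oplus> v) = act M x u \<oplus> act M x v"
    and act_smult_right: "\<And>x c u. u \<in> carrier M \<Longrightarrow> act M x (c \<odot> u) = c \<odot> act M x u"
    and act_bracket: "\<And>x y u. u \<in> carrier M \<Longrightarrow>
          act M (bracket x y) u = act M x (act M y u) \<ominus> act M y (act M x u)"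

definition lie_submodule :: "'u set \<Rightarrow> ('g, 'u) lie_module \<Rightarrow> bool" where
  "lie_submodule N M \<longleftrightarrow> submodule N complex_field M \<and> (\<forall>x. \<forall>u\<in>N. act M x u \<in> N)"

locale irreducible_lie_module = lie_module scale bracket M
  for scale :: "complex \<Rightarrow> 'g::ab_group_add \<Rightarrow> 'g" and bracket :: "'g \<Rightarrow> 'g \<Rightarrow> 'g"
    and M :: "('g, 'u) lie_module" (structure) +
  assumes nonzero: "carrier M \<noteq> {\<zero>}"
    and no_proper_submodule:
      "\<And>N. lie_submodule N M \<Longrightarrow> N = {\<zero>} \<or> N = carrier M"

definition quotient_lie_module ::
    "('g, 'u) lie_module \<Rightarrow> 'u set \<Rightarrow> ('g, 'u set) lie_module" where
  "quotient_lie_module M N =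
     \<lparr>carrier = a_rcosets\<^bsub>M\<^esub> N, monoid.mult = undefined, one = undefined,
      zero = N, add = set_add M,
      module.smult = (\<lambda>c C. \<Union>u\<in>C. N +>\<^bsub>M\<^esub> (c \<odot>\<^bsub>M\<^esub> u)),
      act = (\<lambda>x C. \<Union>u\<in>C. N +>\<^bsub>M\<^esub> act M x u)\<rparr>"


section \<open>Tensor products\<close>

text \<open>
  The tensor product of a family \<open>V\<close> of modules indexed by a finite set \<open>I\<close> is the free vector
  space on the product of the carriers, modulo the relations of multilinearity. The basis vector
  of a tuple \<open>u\<close> is \<^term>\<open>Poly_Mapping.single u 1\<close>.
\<close>

definition pm_scale :: "(complex \<Rightarrow> 'b::ab_group_add \<Rightarrow> 'b) \<Rightarrow>
    complex \<Rightarrow> ('a \<Rightarrow>\<^sub>0 'b) \<Rightarrow> ('a \<Rightarrow>\<^sub>0 'b)" where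
  "pm_scale scale c f = Poly_Mapping.map (scale c) f"

abbreviation tuples :: "'i set \<Rightarrow> ('i \<Rightarrow> ('g, 'u) lie_module) \<Rightarrow> ('i \<Rightarrow> 'u) set" where
  "tuples I V \<equiv> (\<Pi>\<^sub>E i\<in>I. carrier (V i))"

text \<open>
  The action is the linear extension of the Leibniz rule on basis vectors. It is compatible with
  the bracket only modulo the relations.
\<close>

definition free_tensor :: "'i set \<Rightarrow> ('i \<Rightarrow> ('g, 'u) lie_module) \<Rightarrow>
    ('g, ('i \<Rightarrow> 'u) \<Rightarrow>\<^sub>0 complex) lie_module" where
  "free_tensor I V =
     \<lparr>carrier = {f. Poly_Mapping.keys f \<subseteq> tuples I V},
      monoid.mult = undefined, one = undefined,
      zero = 0, add = (+), module.smult = pm_scale (*),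
      act = (\<lambda>x f. \<Sum>u\<in>Poly_Mapping.keys f. \<Sum>i\<in>I.
               Poly_Mapping.single (u(i := act (V i) x (u i))) (Poly_Mapping.lookup f u))\<rparr>"

definition tensor_relations :: "'i set \<Rightarrow> ('i \<Rightarrow> ('g, 'u) lie_module) \<Rightarrow>
    (('i \<Rightarrow> 'u) \<Rightarrow>\<^sub>0 complex) set" where
  "tensor_relations I V = Modules.module.span (pm_scale (*))
     ({Poly_Mapping.single (u(i := a \<oplus>\<^bsub>V i\<^esub> b)) 1
         - Poly_Mapping.single (u(i := a)) 1 - Poly_Mapping.single (u(i := b)) 1 | u i a b.
         u \<in> tuples I V \<and> i \<in> I \<and> a \<in> carrier (V i) \<and> b \<in> carrier (V i)}
      \<union> {Poly_Mapping.single (u(i := c \<odot>\<^bsub>V i\<^esub> a)) 1 - Poly_Mapping.single (u(i := a)) c | u i c a.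
         u \<in> tuples I V \<and> i \<in> I \<and> a \<in> carrier (V i)})"

definition tensor_lie_module :: "'i set \<Rightarrow> ('i \<Rightarrow> ('g, 'u) lie_module) \<Rightarrow>
    ('g, (('i \<Rightarrow> 'u) \<Rightarrow>\<^sub>0 complex) set) lie_module" where
  "tensor_lie_module I V = quotient_lie_module (free_tensor I V) (tensor_relations I V)"


section \<open>The affine Lie algebra and evaluation modules\<close>

text \<open>
  The pair \<open>(f, \<alpha>)\<close> stands for the sum of the \<open>f n \<otimes> t\<^sup>n\<close> over all integers \<open>n\<close>, plus \<open>\<alpha> k\<close>
  with \<open>k\<close> the central generator.
\<close>

type_synonym 'g affine = "(int \<Rightarrow>\<^sub>0 'g) \<times> complex"

definition loop :: "'g::zero \<Rightarrow> int \<Rightarrow> 'g affine" where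
  "loop a n = (Poly_Mapping.single n a, 0)"

definition central :: "'g::zero affine" where
  "central = (0, 1)"

definition affine_scale :: "(complex \<Rightarrow> 'g::ab_group_add \<Rightarrow> 'g) \<Rightarrow>
    complex \<Rightarrow> 'g affine \<Rightarrow> 'g affine" where
  "affine_scale scale c p = (pm_scale scale c (fst p), c * snd p)"

definition affine_bracket :: "('g::ab_group_add \<Rightarrow> 'g \<Rightarrow> 'g) \<Rightarrow> ('g \<Rightarrow> 'g \<Rightarrow> complex) \<Rightarrow>
    'g affine \<Rightarrow> 'g affine \<Rightarrow> 'g affine" where
  "affine_bracket bracket form p q =
     (\<Sum>m\<in>Poly_Mapping.keys (fst p). \<Sum>n\<in>Poly_Mapping.keys (fst q).
        let a = Poly_Mapping.lookup (fst p) m; b = Poly_Mapping.lookup (fst q) n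
        in (Poly_Mapping.single (m + n) (bracket a b),
            of_int m * form a b * (if m + n = 0 then 1 else 0)))"

definition evaluation_module :: "('g::zero, 'u) lie_module \<Rightarrow> complex \<Rightarrow> ('g affine, 'u) lie_module" where
  "evaluation_module U z =
     \<lparr>carrier = carrier U, monoid.mult = monoid.mult U, one = one U,
      zero = zero U, add = add U, module.smult = module.smult U,
      act = (\<lambda>p u. \<Oplus>\<^bsub>U\<^esub>n\<in>Poly_Mapping.keys (fst p).
               (z powi n) \<odot>\<^bsub>U\<^esub> act U (Poly_Mapping.lookup (fst p) n) u)\<rparr>"


section \<open>The definitions on generators\<close>

lemma pm_scale_zero [simp]: "pm_scale scale c 0 = 0"
  by (rule poly_mapping_eqI) (simp add: pm_scale_def Poly_Mapping.map.rep_eq)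

lemma (in lie_algebra) bracket_zero [simp]: "bracket 0 y = 0" "bracket x 0 = 0"
  using Vector_Spaces.linear.axioms(3)[OF bracket_linear_left, THEN module_hom.zero]
    Vector_Spaces.linear.axioms(3)[OF bracket_linear_right, THEN module_hom.zero] by auto

lemma (in lie_algebra_form) form_zero [simp]: "form 0 y = 0" "form x 0 = 0"
  using Vector_Spaces.linear.axioms(3)[OF form_linear_left, THEN module_hom.zero]
    Vector_Spaces.linear.axioms(3)[OF form_linear_right, THEN module_hom.zero] by auto

lemma (in lie_algebra_form) affine_bracket_loop:
  "affine_bracket bracket form (loop a m) (loop b n) =
     loop (bracket a b) (m + n)
       + affine_scale scale (of_int m * form a b * (if m + n = 0 then 1 else 0)) central"
  by (cases "a = 0"; cases "b = 0")
     (auto simp: affine_bracket_def loop_def affine_scale_def central_def zero_prod_def)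

lemma affine_bracket_central:
  "affine_bracket bracket form central p = 0" "affine_bracket bracket form p central = 0"
  by (simp_all add: affine_bracket_def central_def flip: zero_prod_def)

lemma (in lie_module) evaluation_loop:
  assumes "u \<in> carrier M"
  shows "act (evaluation_module M z) (loop a n) u = (z powi n) \<odot> act M a u"
proof (cases "a = 0")
  case True
  have "act M (scale 0 0) u = 0 \<odot> act M 0 u"
    using act_scale_left[OF assms] .
  then have "act M 0 u = \<zero>"
    using M.smult_l_null[OF act_closed[OF assms, of 0]]
    by (simp add: ring_of_type_algebra_def)
  then show ?thesis
    using True M.smult_r_null[of "z powi n"]
    by (simp add: evaluation_module_def loop_def ring_of_type_algebra_def M.finsum_empty)
next
  case False
  then show ?thesis
    using assms act_closed M.smult_closed
    by (simp add: evaluation_module_def loop_def ring_of_type_algebra_def)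
qed

lemma (in lie_module) evaluation_central:
  "act (evaluation_module M z) central u = \<zero>"
  by (simp add: evaluation_module_def central_def)

lemma free_tensor_act_single:
  "act (free_tensor I V) x (Poly_Mapping.single u 1) =
     (\<Sum>i\<in>I. Poly_Mapping.single (u(i := act (V i) x (u i))) 1)"
  by (simp add: free_tensor_def)

end

theory Submission
  imports
    Defs
    "HOL-Analysis.Continuum_Not_Denumerable"
    "HOL-Computational_Algebra.Fundamental_Theorem_Algebra"
begin

text \<open>
  The proof separates the factors first and then treats each of them by a density argument.
  
  As the points \<open>z i\<close> are distinct, Lagrange interpolation provides, for every \<open>x\<close> in the Lie algebra and
  every index \<open>i\<close>, a polynomial multiple of \<open>x\<close> in the loop algebra that acts on the tensor product as
  \<open>x\<close> on the factor \<open>i\<close> and as zero on all other factors. A submodule of the tensor product is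
  therefore stable under the action of the original Lie algebra on each factor separately, hence
  under its enveloping algebra acting on each factor separately. It remains to see that such a
  subspace is zero or everything, which no longer involves the affine Lie algebra.
  
  This is where the dimension of the Lie algebra matters. An irreducible module over a Lie algebra of
  countable dimension has countable dimension, and Dixmier's version of Schur's lemma (\<open>schur\<close>) says
  that its endomorphisms are scalars: if \<open>\<theta>\<close> were not a scalar, then every \<open>\<theta> - \<mu>\<close> would be
  bijective, and the vectors \<open>(\<theta> - \<mu>)\<^sup>-\<^sup>1 w\<close> would be uncountably many linearly independent ones. The usual
  proof of the Jacobson density theorem then shows that the enveloping algebra contains operators
  that kill a given finite set of vectors but not a vector outside its span
  (\<open>algebra_separates\<close>). It follows that on a finite-dimensional subspace the identity is a sum of
  operators from the enveloping algebra that have rank at most one there (\<open>rank_one_decomposition\<close>).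
  
  Let \<open>f\<close> be a nonzero element of a stable subspace. Applying such a decomposition to one factor writes \<open>f\<close>
  as a sum, so one summand is nonzero; it lies in the subspace, and all its entries in that factor
  are multiples of one vector. After all factors have been treated, the subspace contains a nonzero pure
  tensor, and irreducibility of the factors carries this tensor to all pure tensors
  (\<open>slot_stable_subspace_trivial\<close>). All computations take place in the free vector space on
  tuples, modulo the relations of multilinearity.
  
  The linear algebra is done on a whole type. A module with a carrier set is embedded into the free
  vector space on its elements (\<open>linear_coordinates\<close>), where it becomes a subspace.
\<close>

section \<open>Schur's lemma for countable sets of operators\<close>

definition poly_act :: "(complex \<Rightarrow> 'v::ab_group_add \<Rightarrow> 'v) \<Rightarrow> ('v \<Rightarrow> 'v) \<Rightarrow> complex poly \<Rightarrow> 'v \<Rightarrow> 'v" where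
  "poly_act scale \<theta> p w = (\<Sum>k\<le>degree p. scale (coeff p k) ((\<theta> ^^ k) w))"

context vector_space
begin

lemma linear_lincomb:
  assumes "Vector_Spaces.linear scale scale f" "Vector_Spaces.linear scale scale g"
  shows "Vector_Spaces.linear scale scale (\<lambda>v. scale a (f v) + scale b (g v))"
  using assms unfolding Vector_Spaces.linear_iff
  by (auto simp: scale_right_distrib mult.commute)

end

locale linear_operator = vector_space scale
  for scale :: "complex \<Rightarrow> 'v::ab_group_add \<Rightarrow> 'v" +
  fixes \<theta> :: "'v \<Rightarrow> 'v"
  assumes linear_op: "Vector_Spaces.linear scale scale \<theta>"
begin

lemma op_simps: "\<theta> (x + y) = \<theta> x + \<theta> y" "\<theta> (scale c x) = scale c (\<theta> x)" "\<theta> 0 = 0"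
  "\<theta> (x - y) = \<theta> x - \<theta> y"
proof -
  interpret Vector_Spaces.linear scale scale \<theta> by (rule linear_op)
  show "\<theta> (x + y) = \<theta> x + \<theta> y" "\<theta> (scale c x) = scale c (\<theta> x)" "\<theta> 0 = 0"
     "\<theta> (x - y) = \<theta> x - \<theta> y"
    by (auto simp: add scale diff)
qed

lemma op_sum: "\<theta> (sum f A) = (\<Sum>x\<in>A. \<theta> (f x))"
  by (induction A rule: infinite_finite_induct) (auto simp: op_simps)

abbreviation papply :: "complex poly \<Rightarrow> 'v \<Rightarrow> 'v" where "papply \<equiv> poly_act scale \<theta>"

lemma papply_upto: "degree p \<le> n \<Longrightarrow> papply p w = (\<Sum>k\<le>n. scale (coeff p k) ((\<theta> ^^ k) w))"
  unfolding poly_act_def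
  by (rule sum.mono_neutral_left) (auto simp: coeff_eq_0)

lemma papply_0 [simp]: "papply 0 w = 0"
  by (simp add: poly_act_def)

lemma papply_add: "papply (p + q) w = papply p w + papply q w"
  using papply_upto[of p "max (degree p) (degree q)" w]
    papply_upto[of q "max (degree p) (degree q)" w]
    papply_upto[of "p + q" "max (degree p) (degree q)" w]
  by (simp add: degree_add_le_max scale_left_distrib sum.distrib)

lemma papply_smult: "papply (smult c p) w = scale c (papply p w)"
  using papply_upto[of "smult c p" "degree p" w]
  by (simp add: poly_act_def[of _ _ p] scale_sum_right degree_smult_le)

lemma papply_sum: "papply (sum f A) w = (\<Sum>x\<in>A. papply (f x) w)"
  by (induction A rule: infinite_finite_induct) (auto simp: papply_add)

lemma papply_pCons: "papply (pCons a p) w = scale a w + \<theta> (papply p w)"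
proof -
  have "papply (pCons a p) w
      = (\<Sum>k\<le>Suc (degree p). scale (coeff (pCons a p) k) ((\<theta> ^^ k) w))"
    by (rule papply_upto) (simp add: degree_pCons_le)
  also have "\<dots> = scale a w + (\<Sum>k\<le>degree p. scale (coeff p k) (\<theta> ((\<theta> ^^ k) w)))"
    by (subst sum.atMost_Suc_shift) simp
  also have "(\<Sum>k\<le>degree p. scale (coeff p k) (\<theta> ((\<theta> ^^ k) w))) = \<theta> (papply p w)"
    by (simp add: poly_act_def op_sum op_simps)
  finally show ?thesis .
qed

lemma papply_linear: "papply p (v + w) = papply p v + papply p w"
  "papply p (scale c w) = scale c (papply p w)" "papply p (\<theta> w) = \<theta> (papply p w)"
  by (induction p) (simp_all add: papply_pCons op_simps scale_right_distrib mult.commute)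

lemma papply_zero: "papply p 0 = 0"
  using papply_linear(2)[of p 0 0] by simp

lemma papply_diff: "papply p (v - w) = papply p v - papply p w"
  using papply_linear(1)[of p "v - w" w] by (simp add: algebra_simps)

lemma papply_vec_sum: "papply p (sum f A) = (\<Sum>x\<in>A. papply p (f x))"
  by (induction A rule: infinite_finite_induct) (auto simp: papply_linear papply_zero)

lemma papply_linear_factor: "papply ([:-\<mu>, 1:] * p) w = papply p (\<theta> w - scale \<mu> w)"
  proof -
  have "[:-\<mu>, 1:] * p = smult (-\<mu>) p + pCons 0 p" by simp
  then show ?thesis
    by (simp only: papply_add papply_smult papply_pCons papply_diff papply_linear) simp
qed

text \<open>
  The complex numbers are algebraically closed, so \<open>p(\<theta>)\<close> is a product of factors \<open>\<theta> - \<mu>\<close> up to a constant;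
  if no factor has a kernel, neither has the product.
\<close>

lemma papply_injective:
  assumes W: "subspace W" "\<And>w. w \<in> W \<Longrightarrow> \<theta> w \<in> W"
    and inj: "\<And>\<mu> w. w \<in> W \<Longrightarrow> \<theta> w = scale \<mu> w \<Longrightarrow> w = 0"
    and p: "p \<noteq> 0" "w \<in> W" "papply p w = 0"
  shows "w = 0"
  using p
proof (induction "degree p" arbitrary: p w)
  case 0
  then obtain c where "p = [:c:]" by (metis degree_eq_zeroE)
  with 0 show ?case by (simp add: papply_pCons op_simps)
next
  case (Suc n)
  then have "\<not> constant (poly p)" by (simp add: constant_degree)
  then obtain \<mu> where "poly p \<mu> = 0" using fundamental_theorem_of_algebra by blast
  then obtain q where q: "p = [:-\<mu>, 1:] * q" by (metis poly_eq_0_iff_dvd dvdE)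
  with Suc have "q \<noteq> 0" by auto
  then have "degree p = Suc (degree q)" unfolding q by (subst degree_mult_eq) auto
  moreover have "papply q (\<theta> w - scale \<mu> w) = 0"
    using Suc.prems q papply_linear_factor by metis
  moreover have "\<theta> w - scale \<mu> w \<in> W" using Suc.prems W subspace_diff subspace_scale by metis
  ultimately have "\<theta> w - scale \<mu> w = 0" using Suc.hyps \<open>q \<noteq> 0\<close> by (metis nat.inject)
  then show ?case using inj Suc.prems by simp
qed

text \<open>
  The vector \<open>g \<mu>\<close> plays the role of \<open>(\<theta> - \<mu>)\<^sup>-\<^sup>1 w\<close>. Clearing denominators turns a linear relation between
  these vectors into a polynomial in \<open>\<theta>\<close> that kills \<open>w\<close>, which must be the zero polynomial; its value at \<open>\<mu>\<close> is
  a nonzero multiple of the coefficient of \<open>g \<mu>\<close>.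
\<close>

lemma resolvent_independent:
  assumes W: "subspace W" "\<And>w. w \<in> W \<Longrightarrow> \<theta> w \<in> W"
    and inj: "\<And>\<mu> w. w \<in> W \<Longrightarrow> \<theta> w = scale \<mu> w \<Longrightarrow> w = 0"
    and w: "w \<in> W" "w \<noteq> 0" and g: "\<And>\<mu>. g \<mu> \<in> W" "\<And>\<mu>. \<theta> (g \<mu>) - scale \<mu> (g \<mu>) = w"
  shows "independent (range g)" "inj g"
proof -
  show "inj g"
  proof (rule injI)
    fix \<mu> \<nu> assume "g \<mu> = g \<nu>"
    moreover have "g \<mu> \<noteq> 0" using g(2)[of \<mu>] w by (auto simp: op_simps)
    ultimately show "\<mu> = \<nu>" using g(2)[of \<mu>] g(2)[of \<nu>]
      by (metis diff_add_cancel add_left_imp_eq scale_right_imp_eq)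
  qed
  show "independent (range g)"
  unfolding independent_explicit_module
  proof (intro allI impI)
    fix F and c :: "'v \<Rightarrow> complex" and v
    assume F: "finite F" "F \<subseteq> range g" and 0: "(\<Sum>v\<in>F. scale (c v) v) = 0" and v: "v \<in> F"
    define M where "M = g -` F"
    have M: "finite M" "F = g ` M" 
      using F \<open>inj g\<close> by (auto simp: M_def finite_vimageI)
    define q where "q \<mu> = (\<Prod>\<nu>\<in>M - {\<mu>}. [:-\<nu>, 1:])" for \<mu>
    define p where "p = (\<Sum>\<mu>\<in>M. smult (c (g \<mu>)) (q \<mu>))"
    have "papply (\<Prod>\<nu>\<in>M. [:-\<nu>, 1:]) (g \<mu>) = papply (q \<mu>) w" if "\<mu> \<in> M" for \<mu>
      unfolding q_def prod.remove[OF M(1) that] by (subst papply_linear_factor) (simp add: g)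
    moreover have "(\<Sum>\<mu>\<in>M. scale (c (g \<mu>)) (g \<mu>)) = 0"
      using 0 unfolding M(2) by (subst (asm) sum.reindex) (use \<open>inj g\<close> in \<open>auto intro: inj_on_subset\<close>)
    ultimately have "papply p w = 0"
      using papply_vec_sum[of "\<Prod>\<nu>\<in>M. [:-\<nu>, 1:]" "\<lambda>\<mu>. scale (c (g \<mu>)) (g \<mu>)" M]
      by (simp add: p_def papply_sum papply_smult papply_linear papply_zero)
    then have "p = 0" using papply_injective[of W p w] W inj w by blast
    obtain \<mu> where \<mu>: "\<mu> \<in> M" "v = g \<mu>" using v M by auto
    have "poly (q \<nu>) \<mu> = 0" if "\<nu> \<in> M" "\<nu> \<noteq> \<mu>" for \<nu>
      using that \<mu> M by (auto simp: q_def poly_prod prod_zero_iff)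
    then have "poly p \<mu> = c (g \<mu>) * poly (q \<mu>) \<mu>"
      using M \<mu> by (simp add: p_def poly_sum sum.remove[of M \<mu>])
    moreover have "poly (q \<mu>) \<mu> \<noteq> 0" using M by (auto simp: q_def poly_prod)
    ultimately show "c v = 0" using \<open>p = 0\<close> \<mu> by simp
  qed
qed

end

context vector_space
begin

text \<open>
  An element of the span of \<open>D\<close> lies in the span of a finite subset of \<open>D\<close>. There are countably many such
  subsets, and each of these spans contains only finitely many elements of an independent set.
\<close>

lemma independent_countable_if_countable_span:
  assumes D: "countable D" "S \<subseteq> span D" and S: "independent S"
  shows "countable S"
proof -
  have "\<exists>F. finite F \<and> F \<subseteq> D \<and> x \<in> span F" if "x \<in> S" for x
  proof -
    have "x \<in> span D" using that D by auto
    then obtain F r where F: "finite F" "F \<subseteq> D" "x = (\<Sum>a\<in>F. scale (r a) a)"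
      unfolding span_explicit by auto
    then have "x \<in> span F" by (auto intro!: span_sum span_scale intro: span_base)
    then show ?thesis using F by blast
  qed
  then have "S \<subseteq> (\<Union>F\<in>{F. finite F \<and> F \<subseteq> D}. S \<inter> span F)" by blast
  moreover have "countable (\<Union>F\<in>{F. finite F \<and> F \<subseteq> D}. S \<inter> span F)"
  proof (rule countable_UN)
    show "countable {F. finite F \<and> F \<subseteq> D}" 
      using countable_Collect_finite_subset[OF D(1)] by simp
    fix F assume "F \<in> {F. finite F \<and> F \<subseteq> D}"
    then have "finite (S \<inter> span F)"
      using independent_span_bound[of F "S \<inter> span F"] independent_mono[OF S, of "S \<inter> span F"] by auto
    then show "countable (S \<inter> span F)" by (rule countable_finite)
  qed
  ultimately show ?thesis by (rule countable_subset)
qed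

end

text \<open>
  An irreducible representation, seen as a set of operators on a subspace. Countability of the set
  of operators replaces countable dimension of a Lie algebra: the operators of a basis have the same
  stable subspaces as those of the whole algebra.
\<close>

locale irreducible_operators = vector_space scale
  for scale :: "complex \<Rightarrow> 'v::ab_group_add \<Rightarrow> 'v" +
  fixes T :: "('v \<Rightarrow> 'v) set" and W :: "'v set"
  assumes linear_T: "t \<in> T \<Longrightarrow> Vector_Spaces.linear scale scale t"
    and countable_T: "countable T"
    and subspace_W: "subspace W"
    and T_closed: "t \<in> T \<Longrightarrow> w \<in> W \<Longrightarrow> t w \<in> W"
    and nontrivial: "W \<noteq> {0}"
    and irreducible: "subspace N \<Longrightarrow> N \<subseteq> W \<Longrightarrow> (\<And>t w. t \<in> T \<Longrightarrow> w \<in> N \<Longrightarrow> t w \<in> N)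
      \<Longrightarrow> N = {0} \<or> N = W"
begin

lemma irreducible_nonzero:
  assumes "subspace N" "N \<subseteq> W" "\<And>t w. t \<in> T \<Longrightarrow> w \<in> N \<Longrightarrow> t w \<in> N" "x \<in> N" "x \<noteq> 0"
  shows "N = W"
  using irreducible[of N] assms by blast

lemma T_linearity:
  assumes "t \<in> T"
  shows "t (x + y) = t x + t y" "t (scale c x) = scale c (t x)" "t 0 = 0" "t (x - y) = t x - t y"
proof -
  interpret linear_operator scale t by (intro linear_operator.intro linear_operator_axioms.intro vector_space_axioms linear_T[OF assms])
  show "t (x + y) = t x + t y" "t (scale c x) = scale c (t x)" "t 0 = 0" "t (x - y) = t x - t y"
    by (auto simp: op_simps)
qed

text \<open>
  The words in the operators, applied to one nonzero vector, span a stable subspace.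
\<close>

lemma countable_spanning: "\<exists>D. countable D \<and> W \<subseteq> span D"
proof -
  obtain w where w: "w \<in> W" "w \<noteq> 0" using nontrivial subspace_W subspace_0 by blast
  define D where "D = (\<lambda>ts. foldr (\<lambda>t. t) ts w) ` lists T"
  have DW: "D \<subseteq> W" 
  proof -
    have "foldr (\<lambda>t. t) ts w \<in> W" if "ts \<in> lists T" for ts
      using that by (induction ts) (auto simp: w T_closed)
    then show ?thesis by (auto simp: D_def)
  qed
  have "t x \<in> span D" if t: "t \<in> T" and x: "x \<in> span D" for t x
  proof -
    have "t d \<in> D" if "d \<in> D" for d
    proof -
      obtain ts where "ts \<in> lists T" "d = foldr (\<lambda>t. t) ts w" using \<open>d \<in> D\<close> by (auto simp: D_def)
      then have "t d = foldr (\<lambda>t. t) (t # ts) w" "t # ts \<in> lists T" using t by auto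
      then show ?thesis unfolding D_def by blast
    qed
    with x show ?thesis
      by (induction rule: span_induct_alt) 
        (auto simp: T_linearity[OF t] intro!: span_add span_scale span_zero intro: span_base)
  qed
  moreover have "w \<in> span D"
    unfolding D_def by (intro span_base image_eqI[of _ _ "[]"]) auto
  ultimately have "span D = W"
    using w irreducible_nonzero[of "span D" w] span_minimal[OF DW subspace_W] by auto
  moreover have "countable D" unfolding D_def by (intro countable_image countable_lists countable_T)
  ultimately show ?thesis by auto
qed

text \<open>
  Kernel and image of \<open>\<theta> - \<mu>\<close> on \<open>W\<close> are stable subspaces. If \<open>\<theta>\<close> is not a scalar, each kernel is
  zero and each image is \<open>W\<close>, so that \<open>\<theta> - \<mu>\<close> can be inverted at one vector for all of the uncountably many \<open>\<mu>\<close>.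
\<close>

lemma schur:
  assumes lin: "Vector_Spaces.linear scale scale \<theta>"
    and closed: "\<And>w. w \<in> W \<Longrightarrow> \<theta> w \<in> W"
    and comm: "\<And>t w. t \<in> T \<Longrightarrow> w \<in> W \<Longrightarrow> \<theta> (t w) = t (\<theta> w)"
  shows "\<exists>\<mu>. \<forall>w\<in>W. \<theta> w = scale \<mu> w"
proof (rule ccontr)
  assume neg: "\<nexists>\<mu>. \<forall>w\<in>W. \<theta> w = scale \<mu> w"
  interpret linear_operator scale \<theta> by (intro linear_operator.intro linear_operator_axioms.intro vector_space_axioms lin)
  note W_simps = subspace_0[OF subspace_W] subspace_add[OF subspace_W] subspace_scale[OF subspace_W]
    subspace_diff[OF subspace_W]
  have inj: "w = 0" if "w \<in> W" "\<theta> w = scale \<mu> w" for w \<mu>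
  proof (rule ccontr)
    assume "w \<noteq> 0"
    have "{w \<in> W. \<theta> w = scale \<mu> w} = W"
      by (rule irreducible_nonzero[of _ w]) 
        (auto intro!: subspaceI simp: W_simps op_simps scale_right_distrib scale_left_commute comm T_linearity T_closed
          that \<open>w \<noteq> 0\<close>)
    then show False using neg by blast
  qed
  obtain w where w: "w \<in> W" "w \<noteq> 0" using nontrivial subspace_W subspace_0 by blast
  have "\<exists>x\<in>W. \<theta> x - scale \<mu> x = w" for \<mu>
  proof -
    have "(\<lambda>x. \<theta> x - scale \<mu> x) ` W = W"
    proof (rule irreducible_nonzero[of _ "\<theta> w - scale \<mu> w"])
      show "subspace ((\<lambda>x. \<theta> x - scale \<mu> x) ` W)"
      proof (rule subspaceI)
        show "0 \<in> (\<lambda>x. \<theta> x - scale \<mu> x) ` W" by (rule image_eqI[of _ _ 0]) (auto simp: op_simps W_simps)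
        show "x + y \<in> (\<lambda>x. \<theta> x - scale \<mu> x) ` W" if xy: "x \<in> (\<lambda>x. \<theta> x - scale \<mu> x) ` W" "y \<in> (\<lambda>x. \<theta> x - scale \<mu> x) ` W" for x y
        proof -
          obtain a b where "a \<in> W" "b \<in> W" "x = \<theta> a - scale \<mu> a" "y = \<theta> b - scale \<mu> b"
            using xy by blast
          then show ?thesis
            by (intro image_eqI[of _ _ "a + b"]) (auto simp: op_simps W_simps scale_right_distrib add_diff_add)
        qed
        show "scale c x \<in> (\<lambda>x. \<theta> x - scale \<mu> x) ` W" if x: "x \<in> (\<lambda>x. \<theta> x - scale \<mu> x) ` W" for c x
        proof -
          obtain a where "a \<in> W" "x = \<theta> a - scale \<mu> a" using x by blast
          then show ?thesis
            by (intro image_eqI[of _ _ "scale c a"])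
              (auto simp: op_simps W_simps scale_right_diff_distrib mult.commute)
        qed
      qed
      show "(\<lambda>x. \<theta> x - scale \<mu> x) ` W \<subseteq> W" by (auto simp: W_simps closed)
      show "t x \<in> (\<lambda>x. \<theta> x - scale \<mu> x) ` W" if t: "t \<in> T" and x: "x \<in> (\<lambda>x. \<theta> x - scale \<mu> x) ` W" for t x
      proof -
        obtain a where "a \<in> W" "x = \<theta> a - scale \<mu> a" using x by blast
        then show ?thesis
          by (intro image_eqI[of _ _ "t a"]) (auto simp: T_linearity[OF t] comm[OF t] T_closed[OF t])
      qed
      show "\<theta> w - scale \<mu> w \<noteq> 0" using inj w by auto
    qed (use w in auto)
    then have "w \<in> (\<lambda>x. \<theta> x - scale \<mu> x) ` W" using w by simp
    then show ?thesis by (rule imageE) auto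
  qed
  then obtain g where g: "\<And>\<mu>. g \<mu> \<in> W" "\<And>\<mu>. \<theta> (g \<mu>) - scale \<mu> (g \<mu>) = w"
    unfolding Bex_def by atomize_elim (use choice[of "\<lambda>\<mu> x. x \<in> W \<and> \<theta> x - scale \<mu> x = w"] in blast)
  have ind: "independent (range g)" "inj g"
    by (rule resolvent_independent[of W w g]; fact subspace_W closed inj w g)+
  obtain D where "countable D" "W \<subseteq> span D" using countable_spanning by blast
  then have "countable (range g)"
    using g(1) by (intro independent_countable_if_countable_span[OF _ _ ind(1), of D]) auto
  then have "countable (UNIV :: complex set)" using ind(2) by (rule countable_image_inj_on)
  then show False using uncountable_UNIV_complex by blast
qed

section \<open>The density theorem\<close>

inductive_set generated_algebra :: "('v \<Rightarrow> 'v) set" where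
  gen: "t \<in> T \<Longrightarrow> t \<in> generated_algebra"
| ident: "(\<lambda>v. v) \<in> generated_algebra"
| comp: "a \<in> generated_algebra \<Longrightarrow> b \<in> generated_algebra \<Longrightarrow> (\<lambda>v. a (b v)) \<in> generated_algebra"
| lincomb: "a \<in> generated_algebra \<Longrightarrow> b \<in> generated_algebra \<Longrightarrow>
    (\<lambda>v. scale c (a v) + scale d (b v)) \<in> generated_algebra"

lemma algebra_linear:
  assumes "a \<in> generated_algebra"
  shows "Vector_Spaces.linear scale scale a"
  using assms
proof induction
  case (comp a b)
  then show ?case using Vector_Spaces.linear_compose[of scale scale b scale a] by (simp add: comp_def)
next
  case (lincomb a b c d)
  then show ?case by (intro linear_lincomb)
qed (auto intro: linear_T linear_ident)

lemma algebra_linearity: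
  assumes "a \<in> generated_algebra"
  shows "a (x + y) = a x + a y" "a (scale c x) = scale c (a x)" "a 0 = 0" "a (x - y) = a x - a y"
proof -
  interpret linear_operator scale a by (intro linear_operator.intro linear_operator_axioms.intro vector_space_axioms algebra_linear[OF assms])
  show "a (x + y) = a x + a y" "a (scale c x) = scale c (a x)" "a 0 = 0" "a (x - y) = a x - a y"
    by (auto simp: op_simps)
qed

lemma algebra_zero_on_span:
  assumes "a \<in> generated_algebra" "\<And>x. x \<in> S \<Longrightarrow> a x = 0" "y \<in> span S"
  shows "a y = 0"
  using assms(3)
  by (induction rule: span_induct_alt) (auto simp: algebra_linearity[OF assms(1)] assms(2))

lemma algebra_closed: "a \<in> generated_algebra \<Longrightarrow> w \<in> W \<Longrightarrow> a w \<in> W"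
  by (induction a arbitrary: w rule: generated_algebra.induct)
    (auto simp: T_closed subspace_add[OF subspace_W] subspace_scale[OF subspace_W])

text \<open>
  A left ideal maps a vector onto a stable subspace. Left ideals occur below as annihilators of
  finite sets.
\<close>

lemma left_ideal_orbit:
  assumes L: "L \<subseteq> generated_algebra" "\<And>t a. t \<in> T \<Longrightarrow> a \<in> L \<Longrightarrow> (\<lambda>v. t (a v)) \<in> L"
    "\<And>a b c d. a \<in> L \<Longrightarrow> b \<in> L \<Longrightarrow> (\<lambda>v. scale c (a v) + scale d (b v)) \<in> L"
    and x: "x \<in> W" "a \<in> L" "a x \<noteq> 0" and v: "v \<in> W"
  shows "\<exists>b\<in>L. b x = v"
proof -
  have "(\<lambda>b. b x) ` L = W"
  proof (rule irreducible_nonzero[of _ "a x"])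
    have lc: "scale c y + scale d z \<in> (\<lambda>b. b x) ` L" if "y \<in> (\<lambda>b. b x) ` L" "z \<in> (\<lambda>b. b x) ` L" for c d y z
      using that L(3)[of _ _ c d] by (auto intro!: image_eqI[of _ _ "\<lambda>v. scale c (_ v) + scale d (_ v)"])
    show "subspace ((\<lambda>b. b x) ` L)"
    proof (rule subspaceI)
      have ax: "a x \<in> (\<lambda>b. b x) ` L" using x by blast
      show "0 \<in> (\<lambda>b. b x) ` L" using lc[OF ax ax, of 0 0] by simp
      show "y + z \<in> (\<lambda>b. b x) ` L" if "y \<in> (\<lambda>b. b x) ` L" "z \<in> (\<lambda>b. b x) ` L" for y z
        using lc[OF that, of 1 1] by simp
      show "scale c y \<in> (\<lambda>b. b x) ` L" if "y \<in> (\<lambda>b. b x) ` L" for c y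
        using lc[OF that that, of c 0] by simp
    qed
    show "(\<lambda>b. b x) ` L \<subseteq> W" using L(1) x(1) algebra_closed by blast
    show "t w \<in> (\<lambda>b. b x) ` L" if "t \<in> T" "w \<in> (\<lambda>b. b x) ` L" for t w
      using that L(2)[of t] by (auto intro!: image_eqI[of _ _ "\<lambda>v. t (_ v)"])
  qed (use x in auto)
  then show ?thesis using v by blast
qed

lemma algebra_transitive:
  assumes "x \<in> W" "x \<noteq> 0" "v \<in> W"
  shows "\<exists>a\<in>generated_algebra. a x = v"
  by (rule left_ideal_orbit[of _ _ "\<lambda>v. v"])
    (use assms in \<open>auto intro: generated_algebra.intros\<close>)

text \<open>
  This is the core of Jacobson's density theorem. In the induction step let \<open>L\<close> be the annihilator of \<open>S\<close>.
  If every element of \<open>L\<close> that kills \<open>x\<close> also kills \<open>u\<close>, then \<open>a x \<mapsto> a u\<close> for \<open>a \<in> L\<close> is a well-defined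
  endomorphism of \<open>W\<close>, hence a scalar \<open>\<mu>\<close>. So \<open>L\<close> kills \<open>u - \<mu> x\<close>, which by the induction hypothesis lies in
  the span of \<open>S\<close>.
\<close>

lemma algebra_separates:
  assumes "finite S" "S \<subseteq> W" "u \<in> W" "u \<notin> span S"
  shows "\<exists>a\<in>generated_algebra. (\<forall>x\<in>S. a x = 0) \<and> a u \<noteq> 0"
  using assms
proof (induction S arbitrary: u)
  case empty
  then show ?case by (auto intro!: bexI[of _ "\<lambda>v. v"] ident)
next
  case (insert x S)
  define L where "L = {a \<in> generated_algebra. \<forall>y\<in>S. a y = 0}"
  show ?case
  proof (cases "x \<in> span S")
    case True
    then have "u \<notin> span S" using insert.prems span_redundant by simp
    then obtain a where a: "a \<in> generated_algebra" "\<forall>x\<in>S. a x = 0" "a u \<noteq> 0"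
      using insert.IH[of u] insert.prems by blast
    moreover have "a x = 0" using algebra_zero_on_span[OF a(1) _ True] a by blast
    ultimately show ?thesis by auto
  next
    case x: False
    show ?thesis
    proof (rule ccontr)
      assume neg: "\<not> ?thesis"
      have L: "L \<subseteq> generated_algebra" "\<And>t a. t \<in> T \<Longrightarrow> a \<in> L \<Longrightarrow> (\<lambda>v. t (a v)) \<in> L"
        "\<And>a b c d. a \<in> L \<Longrightarrow> b \<in> L \<Longrightarrow> (\<lambda>v. scale c (a v) + scale d (b v)) \<in> L"
        by (auto simp: L_def T_linearity intro: generated_algebra.intros generated_algebra.comp[OF gen])
      have xW: "x \<in> W" and uW: "u \<in> W" using insert by auto
      obtain a0 where a0: "a0 \<in> L" "a0 x \<noteq> 0"
        using insert.IH[OF _ xW x] insert.prems by (auto simp: L_def)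
      have onto: "\<exists>b\<in>L. b x = v" if "v \<in> W" for v
        by (rule left_ideal_orbit[of L x a0 v]) (fact L xW a0 that)+
      have well: "a u = 0" if "a \<in> L" "a x = 0" for a
        using neg that by (auto simp: L_def)
      \<comment> \<open>The endomorphism is prescribed on a basis of \<open>W\<close> only, which makes it linear on the whole type;
        that it sends \<open>a x\<close> to \<open>a u\<close> for every \<open>a\<close> in \<open>L\<close> then follows from \<open>well\<close>.\<close>
      obtain B where B: "B \<subseteq> W" "independent B" "W \<subseteq> span B"
        using maximal_independent_subset by blast
      have "\<forall>b\<in>B. \<exists>a. a \<in> L \<and> a x = b" using onto B(1) by blast
      then obtain f where f: "\<And>b. b \<in> B \<Longrightarrow> f b \<in> L \<and> f b x = b" by metis
      interpret pair: vector_space_pair scale scale by unfold_locales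
      obtain \<theta> where lin: "Vector_Spaces.linear scale scale \<theta>"
          and \<theta>B: "\<And>b. b \<in> B \<Longrightarrow> \<theta> b = f b u"
        using pair.linear_independent_extend[OF B(2), of "\<lambda>b. f b u"] by auto
      interpret \<theta>: linear_operator scale \<theta> by (intro linear_operator.intro linear_operator_axioms.intro vector_space_axioms lin)
      have key: "\<exists>a\<in>L. a x = w \<and> \<theta> w = a u" if "w \<in> span B" for w
        using that
      proof (induction rule: span_induct_alt)
        case base
        obtain a where "a \<in> L" using onto[OF xW] by blast
        then have "(\<lambda>v. scale 0 (a v) + scale 0 (a v)) \<in> L" by (rule L(3)[OF _ \<open>a \<in> L\<close>])
        then show ?case by (intro bexI[of _ "\<lambda>v. scale 0 (a v) + scale 0 (a v)"]) (auto simp: \<theta>.op_simps)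
      next
        case (step c b y)
        then obtain a where a: "a \<in> L" "a x = y" "\<theta> y = a u" by blast
        have "(\<lambda>v. scale c (f b v) + scale 1 (a v)) \<in> L" using L(3) f step(1) a by blast
        then show ?case
          by (intro bexI[of _ "\<lambda>v. scale c (f b v) + scale 1 (a v)"])
            (use a f[OF step(1)] in \<open>auto simp: \<theta>.op_simps \<theta>B[OF step(1)]\<close>)
      qed
      have \<theta>: "\<theta> (a x) = a u" if a: "a \<in> L" for a
      proof -
        have "a x \<in> W" using a L(1) xW algebra_closed by blast
        then obtain b where b: "b \<in> L" "b x = a x" "\<theta> (a x) = b u" using key B(3) by blast
        have "(\<lambda>v. scale 1 (a v) + scale (-1) (b v)) \<in> L" using L(3) a b by blast
        from well[OF this] b show ?thesis by simp
      qed
      have "\<exists>\<mu>. \<forall>w\<in>W. \<theta> w = scale \<mu> w"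
      proof (rule schur[OF lin])
        fix w assume "w \<in> W"
        then obtain a where a: "a \<in> L" "a x = w" using onto by blast
        then show "\<theta> w \<in> W" using \<theta>[OF a(1)] a L(1) uW algebra_closed by auto
        fix t assume t: "t \<in> T"
        show "\<theta> (t w) = t (\<theta> w)" using \<theta>[OF L(2)[OF t a(1)]] \<theta>[OF a(1)] a(2) by simp
      qed
      then obtain \<mu> where \<mu>: "\<And>w. w \<in> W \<Longrightarrow> \<theta> w = scale \<mu> w" by blast
      have "u - scale \<mu> x \<in> span S"
      proof (rule ccontr)
        assume notin: "u - scale \<mu> x \<notin> span S"
        have "u - scale \<mu> x \<in> W"
          using uW xW subspace_W subspace_diff subspace_scale by metis
        from insert.IH[OF _ this notin] obtain a where a: "a \<in> L" "a (u - scale \<mu> x) \<noteq> 0"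
          using insert.prems by (auto simp: L_def)
        have "a x \<in> W" using a L(1) xW algebra_closed by blast
        then have "a u = scale \<mu> (a x)" using \<mu> \<theta>[OF a(1)] by simp
        then show False using a L(1) by (auto simp: algebra_linearity)
      qed
      then show False using insert.prems span_breakdown_eq by blast
    qed
  qed
qed

text \<open>
  If \<open>u\<close> is not in the span of \<open>S\<close>, density yields an operator \<open>p\<close> that kills \<open>S\<close> and fixes \<open>u\<close>. A decomposition
  \<open>as\<close> for \<open>S\<close> is corrected to one for \<open>insert u S\<close> by adding \<open>p\<close> and replacing each \<open>a\<close> by \<open>a - a p\<close>, which
  agrees with \<open>a\<close> on the span of \<open>S\<close> and kills \<open>u\<close>.
\<close>

lemma rank_one_decomposition:
  assumes "finite S" "S \<subseteq> W"
  shows "\<exists>as. set as \<subseteq> generated_algebra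
    \<and> (\<forall>a\<in>set as. \<exists>e\<in>W. \<forall>x\<in>span S. \<exists>c. a x = scale c e)
    \<and> (\<forall>x\<in>span S. (\<Sum>a\<leftarrow>as. a x) = x)"
  using assms
proof (induction S)
  case empty
  then show ?case by (intro exI[of _ "[]"]) auto
next
  case (insert u S)
  then obtain as where as: "set as \<subseteq> generated_algebra"
      "\<And>a. a \<in> set as \<Longrightarrow> \<exists>e\<in>W. \<forall>x\<in>span S. \<exists>c. a x = scale c e"
      "\<And>x. x \<in> span S \<Longrightarrow> (\<Sum>a\<leftarrow>as. a x) = x"
    by auto
  have uW: "u \<in> W" using insert by auto
  show ?case
  proof (cases "u \<in> span S")
    case True
    then have "span (insert u S) = span S" by (rule span_redundant)
    then show ?thesis using as by (intro exI[of _ as]) auto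
  next
    case False
    then obtain a where a: "a \<in> generated_algebra" "\<forall>x\<in>S. a x = 0" "a u \<noteq> 0"
      using algebra_separates[of S u] insert.prems \<open>finite S\<close> by auto
    obtain b where b: "b \<in> generated_algebra" "b (a u) = u"
      using algebra_transitive[OF algebra_closed[OF a(1) uW] a(3) uW] by blast
    define p where "p v = b (a v)" for v
    have p: "p \<in> generated_algebra" unfolding p_def by (rule comp[OF b(1) a(1)])
    have pX: "p x = 0" if "x \<in> span S" for x
      unfolding p_def using algebra_zero_on_span[OF a(1) _ that] a(2) algebra_linearity(3)[OF b(1)] by simp
    have pu: "p u = u" by (simp add: p_def b)
    define as' where "as' = p # map (\<lambda>a v. scale 1 (a v) + scale (-1) (a (p v))) as"
    have decomp: "\<exists>c y. y \<in> span S \<and> x = y + scale c u" if x: "x \<in> span (insert u S)" for x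
    proof -
      obtain c where "x - scale c u \<in> span S" using x unfolding span_breakdown_eq by blast
      then show ?thesis by (intro exI[of _ c] exI[of _ "x - scale c u"]) simp
    qed
    have p': "p (y + scale c u) = scale c u" if "y \<in> span S" for y c
      using pX[OF that] pu by (simp add: algebra_linearity[OF p])
    have as_p: "a (y + scale c u) - a (p (y + scale c u)) = a y"
      if "a \<in> set as" "y \<in> span S" for a y c
    proof -
      have "a \<in> generated_algebra" using that as by auto
      then show ?thesis by (simp add: p'[OF that(2)] algebra_linearity)
    qed
    show ?thesis
    proof (intro exI[of _ as'] conjI ballI)
      have "(\<lambda>v. scale 1 (a v) + scale (-1) (a (p v))) \<in> generated_algebra" if "a \<in> set as" for a
      proof -
        have "a \<in> generated_algebra" using that as(1) by auto
        from lincomb[OF this comp[OF this p], of 1 "-1"] show ?thesis .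
      qed
      then show "set as' \<subseteq> generated_algebra" using p by (auto simp: as'_def)
    next
      fix a assume "a \<in> set as'"
      then consider "a = p" | a' where "a' \<in> set as" "a = (\<lambda>v. a' v - a' (p v))"
        by (auto simp: as'_def)
      then show "\<exists>e\<in>W. \<forall>x\<in>span (insert u S). \<exists>c. a x = scale c e"
      proof cases
        case 1
        have "\<exists>c. a x = scale c u" if "x \<in> span (insert u S)" for x
          using decomp[OF that] p' 1 by blast
        then show ?thesis using uW by blast
      next
        case 2
        then obtain e where "e \<in> W" "\<And>x. x \<in> span S \<Longrightarrow> \<exists>c. a' x = scale c e" using as(2) by blast
        moreover have "\<exists>y\<in>span S. a x = a' y" if "x \<in> span (insert u S)" for x
          using decomp[OF that] as_p[OF 2(1)] 2(2) by blast
        ultimately show ?thesis by metis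
      qed
    next
      fix x assume "x \<in> span (insert u S)"
      then obtain c y where y: "y \<in> span S" "x = y + scale c u" using decomp by blast
      have "(\<Sum>a\<leftarrow>as'. a x) = p x + (\<Sum>a\<leftarrow>as. a x - a (p x))"
        by (simp add: as'_def comp_def)
      also have "(\<Sum>a\<leftarrow>as. a x - a (p x)) = (\<Sum>a\<leftarrow>as. a y)"
        using as_p[OF _ y(1)] y(2) by (intro arg_cong[of _ _ sum_list] map_cong) auto
      finally show "(\<Sum>a\<leftarrow>as'. a x) = x" using as(3)[OF y(1)] p'[OF y(1)] y(2) by simp
    qed
  qed
qed

end

section \<open>Embedding the carrier of a module into a vector space\<close>

lemma complex_field_simps [simp]:
  "carrier complex_field = UNIV" "x \<oplus>\<^bsub>complex_field\<^esub> y = x + y" "x \<otimes>\<^bsub>complex_field\<^esub> y = x * y"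
  "\<one>\<^bsub>complex_field\<^esub> = 1" "\<zero>\<^bsub>complex_field\<^esub> = 0"
  by (simp_all add: ring_of_type_algebra_def)

lemma lookup_pm_scale:
  assumes "vector_space scale"
  shows "Poly_Mapping.lookup (pm_scale scale c f) k = scale c (Poly_Mapping.lookup f k)"
proof -
  interpret vector_space scale by fact
  show ?thesis by (simp add: pm_scale_def Poly_Mapping.map.rep_eq when_def)
qed

lemma vector_space_pm_scale:
  assumes "vector_space scale"
  shows "vector_space (pm_scale scale :: complex \<Rightarrow> ('a \<Rightarrow>\<^sub>0 'b::ab_group_add) \<Rightarrow> _)"
proof -
  interpret vector_space scale by fact
  show ?thesis
    by unfold_locales (auto intro!: poly_mapping_eqI
        simp: lookup_pm_scale[OF assms] lookup_add scale_right_distrib scale_left_distrib)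
qed

interpretation complex_vs: vector_space "(*) :: complex \<Rightarrow> complex \<Rightarrow> complex"
  by unfold_locales (auto simp: algebra_simps)

interpretation pm: vector_space "pm_scale ((*) :: complex \<Rightarrow> complex \<Rightarrow> complex) :: _ \<Rightarrow> ('a \<Rightarrow>\<^sub>0 complex) \<Rightarrow> _"
  by (rule vector_space_pm_scale[OF complex_vs.vector_space_axioms])

lemmas lookup_pm_scale_complex [simp] = lookup_pm_scale[OF complex_vs.vector_space_axioms]

lemma pm_scale_single [simp]:
  "pm_scale (*) c (Poly_Mapping.single u d) = Poly_Mapping.single u (c * d :: complex)"
  by (rule poly_mapping_eqI) (auto simp: lookup_single when_def)

lemma (in abelian_group) finsum_keys_superset:
  assumes "\<And>k x. h k x \<in> carrier G" "\<And>k. h k 0 = \<zero>" "finite S" "Poly_Mapping.keys f \<subseteq> S"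
  shows "(\<Oplus>k\<in>Poly_Mapping.keys f. h k (Poly_Mapping.lookup f k)) = (\<Oplus>k\<in>S. h k (Poly_Mapping.lookup f k))"
  using assms
  by (intro add.finprod_mono_neutral_cong_left) (auto simp: in_keys_iff)

lemma (in abelian_group) finsum_keys_add:
  fixes f g :: "'k \<Rightarrow>\<^sub>0 'd::monoid_add"
  assumes h: "\<And>k x. h k x \<in> carrier G" "\<And>k x y. h k (x + y) = h k x \<oplus> h k y"
  shows "(\<Oplus>k\<in>Poly_Mapping.keys (f + g). h k (Poly_Mapping.lookup (f + g) k)) =
     (\<Oplus>k\<in>Poly_Mapping.keys f. h k (Poly_Mapping.lookup f k)) \<oplus>
     (\<Oplus>k\<in>Poly_Mapping.keys g. h k (Poly_Mapping.lookup g k))"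
proof -
  have h0: "h k 0 = \<zero>" for k
    using h(2)[of k 0 0] h(1)[of k 0] by simp
  define S where "S = Poly_Mapping.keys f \<union> Poly_Mapping.keys g"
  have S: "finite S" by (simp add: S_def)
  note sup = finsum_keys_superset[of h S, OF h(1) h0 S]
  have "(\<Oplus>k\<in>Poly_Mapping.keys (f + g). h k (Poly_Mapping.lookup (f + g) k)) =
      (\<Oplus>k\<in>S. h k (Poly_Mapping.lookup (f + g) k))"
    using keys_add[of f g] by (intro sup) (auto simp: S_def)
  also have "\<dots> = (\<Oplus>k\<in>S. h k (Poly_Mapping.lookup f k) \<oplus> h k (Poly_Mapping.lookup g k))"
    by (simp add: lookup_add h)
  also have "\<dots> = (\<Oplus>k\<in>S. h k (Poly_Mapping.lookup f k)) \<oplus> (\<Oplus>k\<in>S. h k (Poly_Mapping.lookup g k))"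
    by (rule finsum_addf) (auto simp: h)
  also have "(\<Oplus>k\<in>S. h k (Poly_Mapping.lookup f k)) = (\<Oplus>k\<in>Poly_Mapping.keys f. h k (Poly_Mapping.lookup f k))"
    by (rule sup[symmetric]) (auto simp: S_def)
  also have "(\<Oplus>k\<in>S. h k (Poly_Mapping.lookup g k)) = (\<Oplus>k\<in>Poly_Mapping.keys g. h k (Poly_Mapping.lookup g k))"
    by (rule sup[symmetric]) (auto simp: S_def)
  finally show ?thesis .
qed

locale complex_module = Module.module complex_field M
  for M :: "(complex, 'u, 'm) module_scheme" (structure)
begin

lemma smult_simps [simp]: "u \<in> carrier M \<Longrightarrow> c \<odot> u \<in> carrier M" "u \<in> carrier M \<Longrightarrow> 1 \<odot> u = u"
  "u \<in> carrier M \<Longrightarrow> 0 \<odot> u = \<zero>" "c \<odot> \<zero> = \<zero>"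
  using smult_closed[of c u] smult_one[of u] smult_l_null[of u] smult_r_null[of c] by simp_all

lemma smult_add_left: "u \<in> carrier M \<Longrightarrow> (c + d) \<odot> u = c \<odot> u \<oplus> d \<odot> u"
  using smult_l_distr[of c d u] by simp

lemma smult_add_right: "u \<in> carrier M \<Longrightarrow> v \<in> carrier M \<Longrightarrow> c \<odot> (u \<oplus> v) = c \<odot> u \<oplus> c \<odot> v"
  using smult_r_distr[of c u v] by simp

lemma smult_smult: "u \<in> carrier M \<Longrightarrow> c \<odot> (d \<odot> u) = (c * d) \<odot> u"
  using smult_assoc1[of c d u] by simp

lemma smult_minus_one: "u \<in> carrier M \<Longrightarrow> (-1) \<odot> u = \<ominus> u"
  using smult_add_left[of u "-1" 1] by (intro minus_equality[symmetric]) auto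

text \<open>
  The linear map \<open>E\<close> evaluates formal linear combinations of elements of the module, ignoring those
  outside the carrier, and \<open>J\<close> is a linear section of it. To obtain \<open>J\<close>, a basis of the kernel \<open>K\<close> of \<open>E\<close> is
  extended to a basis of the whole space, which gives a projection \<open>P\<close> with kernel \<open>K\<close>.
\<close>

lemma linear_coordinates:
  "\<exists>E (J :: 'u \<Rightarrow> ('u \<Rightarrow>\<^sub>0 complex)).
    (\<forall>f. E f \<in> carrier M) \<and> (\<forall>f g. E (f + g) = E f \<oplus> E g) \<and> (\<forall>c f. E (pm_scale (*) c f) = c \<odot> E f) \<and>
    (\<forall>u\<in>carrier M. E (J u) = u) \<and>
    (\<forall>u\<in>carrier M. \<forall>v\<in>carrier M. J (u \<oplus> v) = J u + J v) \<and>
    (\<forall>c. \<forall>u\<in>carrier M. J (c \<odot> u) = pm_scale (*) c (J u))"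
proof -
  define h where "h u c = (if u \<in> carrier M then c \<odot> u else \<zero>)" for u c
  define E where "E f = (\<Oplus>u\<in>Poly_Mapping.keys f. h u (Poly_Mapping.lookup f u))" for f
  have h: "h u c \<in> carrier M" "h u (c + d) = h u c \<oplus> h u d" "h u (c * d) = c \<odot> h u d" "h u 0 = \<zero>" for u c d
    by (auto simp: h_def smult_add_left smult_smult)
  have E_closed: "E f \<in> carrier M" for f
    unfolding E_def by (intro finsum_closed) (auto simp: h)
  have E_add: "E (f + g) = E f \<oplus> E g" for f g
    unfolding E_def by (intro finsum_keys_add h)
  have E_scale: "E (pm_scale (*) c f) = c \<odot> E f" for c f
  proof -
    have "E (pm_scale (*) c f) = (\<Oplus>u\<in>Poly_Mapping.keys f. h u (Poly_Mapping.lookup (pm_scale (*) c f) u))"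
      unfolding E_def by (intro finsum_keys_superset h) (auto simp: in_keys_iff)
    also have "\<dots> = (\<Oplus>u\<in>Poly_Mapping.keys f. c \<odot> h u (Poly_Mapping.lookup f u))"
      by (simp add: h)
    also have "\<dots> = c \<odot> E f"
      unfolding E_def by (subst finsum_smult_ldistr) (auto simp: h)
    finally show ?thesis .
  qed
  have E_single: "E (Poly_Mapping.single u 1) = u" if "u \<in> carrier M" for u
    using that by (simp add: E_def h_def)
  have E_0: "E 0 = \<zero>" by (simp add: E_def)
  have E_diff: "E (f - g) = E f \<ominus> E g" for f g
    using E_add[of "f - g" g] E_closed by (simp add: a_minus_def a_assoc r_neg)
  define K where "K = {f. E f = \<zero>}"
  have K: "pm.subspace K"
    by (rule pm.subspaceI) (auto simp: K_def E_0 E_add E_scale)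
  obtain B where B: "B \<subseteq> K" "pm.independent B" "K \<subseteq> pm.span B"
    using pm.maximal_independent_subset by blast
  obtain B' where B': "B \<subseteq> B'" "pm.independent B'" "UNIV \<subseteq> pm.span B'"
    using pm.maximal_independent_subset_extend[OF _ B(2), of UNIV] by auto
  interpret pair: vector_space_pair
    "pm_scale (*) :: complex \<Rightarrow> ('u \<Rightarrow>\<^sub>0 complex) \<Rightarrow> _" "pm_scale (*) :: complex \<Rightarrow> ('u \<Rightarrow>\<^sub>0 complex) \<Rightarrow> _"
    by unfold_locales
  obtain P where lin: "Vector_Spaces.linear (pm_scale (*)) (pm_scale (*)) P"
    and P: "\<And>b. b \<in> B' \<Longrightarrow> P b = (if b \<in> B then 0 else b)"
    using pair.linear_independent_extend[OF B'(2), of "\<lambda>b. if b \<in> B then 0 else b"] by auto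
  interpret P: linear_operator "pm_scale (*)" P
    by (intro linear_operator.intro linear_operator_axioms.intro pm.vector_space_axioms lin)
  have PK: "P f = 0" if "f \<in> K" for f
  proof -
    have "f \<in> pm.span B" using that B by auto
    then show ?thesis
      by (induction rule: pm.span_induct_alt) (use B' P in \<open>auto simp: P.op_simps\<close>)
  qed
  have EP: "E (P f) = E f" for f
  proof -
    have "f \<in> pm.span B'" using B' by auto
    then show ?thesis
    proof (induction rule: pm.span_induct_alt)
      case base then show ?case by (simp add: P.op_simps)
    next
      case (step c b y)
      have "E (P b) = E b" using P[OF step(1)] B(1) by (auto simp: K_def E_0)
      then show ?case using step by (simp add: P.op_simps E_add E_scale)
    qed
  qed
  define J where "J u = P (Poly_Mapping.single u 1)" for u
  show ?thesis
  proof (intro exI[of _ E] exI[of _ J] conjI allI ballI)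
    show "E (J u) = u" if "u \<in> carrier M" for u
      using that by (simp add: J_def EP E_single)
    show "J (u \<oplus> v) = J u + J v" if "u \<in> carrier M" "v \<in> carrier M" for u v
    proof -
      have "Poly_Mapping.single (u \<oplus> v) 1 - (Poly_Mapping.single u 1 + Poly_Mapping.single v 1) \<in> K"
        using that by (auto simp: K_def E_diff E_add E_single a_minus_def r_neg)
      from PK[OF this] show ?thesis by (simp add: P.op_simps J_def)
    qed
    show "J (c \<odot> u) = pm_scale (*) c (J u)" if "u \<in> carrier M" for c u
    proof -
      have "Poly_Mapping.single (c \<odot> u) 1 - pm_scale (*) c (Poly_Mapping.single u 1) \<in> K"
        using that by (simp del: pm_scale_single add: K_def E_diff E_scale E_single a_minus_def r_neg)
      from PK[OF this] show ?thesis by (simp del: pm_scale_single add: P.op_simps J_def)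
    qed
  qed (fact E_closed E_add E_scale)+
qed

text \<open>
  A suitable coordinate of the image under the embedding, rescaled.
\<close>

lemma exists_linear_functional:
  assumes "u \<in> carrier M" "u \<noteq> \<zero>"
  obtains \<phi> :: "'u \<Rightarrow> complex" where "\<phi> u = 1"
    "\<And>v w. v \<in> carrier M \<Longrightarrow> w \<in> carrier M \<Longrightarrow> \<phi> (v \<oplus> w) = \<phi> v + \<phi> w"
    "\<And>c v. v \<in> carrier M \<Longrightarrow> \<phi> (c \<odot> v) = c * \<phi> v"
proof -
  obtain E and J :: "'u \<Rightarrow> ('u \<Rightarrow>\<^sub>0 complex)" where JE:
    "\<And>f. E f \<in> carrier M" "\<And>f g. E (f + g) = E f \<oplus> E g" "\<And>c f. E (pm_scale (*) c f) = c \<odot> E f"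
    "\<And>u. u \<in> carrier M \<Longrightarrow> E (J u) = u"
    "\<And>u v. u \<in> carrier M \<Longrightarrow> v \<in> carrier M \<Longrightarrow> J (u \<oplus> v) = J u + J v"
    "\<And>c u. u \<in> carrier M \<Longrightarrow> J (c \<odot> u) = pm_scale (*) c (J u)"
    using linear_coordinates by blast
  have "J u \<noteq> 0"
  proof
    assume "J u = 0"
    then have "u = E 0" using JE(4)[OF assms(1)] by simp
    then show False using assms(2) JE(1)[of 0] JE(3)[of 0 0] by simp
  qed
  then obtain k where k: "Poly_Mapping.lookup (J u) k \<noteq> 0"
    by (metis lookup_zero poly_mapping_eqI)
  show ?thesis
    by (rule that[of "\<lambda>v. Poly_Mapping.lookup (J v) k / Poly_Mapping.lookup (J u) k"])
      (use k in \<open>auto simp: JE lookup_add add_divide_distrib\<close>)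
qed

end

section \<open>Density for irreducible modules over a Lie algebra\<close>

text \<open>
  On the carrier these are the operators through which the universal enveloping algebra acts.
\<close>

inductive_set enveloping :: "('g, 'u) lie_module \<Rightarrow> ('u \<Rightarrow> 'u) set" for M (structure) where
  gen: "act M x \<in> enveloping M"
| ident: "(\<lambda>u. u) \<in> enveloping M"
| comp: "a \<in> enveloping M \<Longrightarrow> b \<in> enveloping M \<Longrightarrow> (\<lambda>u. a (b u)) \<in> enveloping M"
| lincomb: "a \<in> enveloping M \<Longrightarrow> b \<in> enveloping M \<Longrightarrow> (\<lambda>u. c \<odot> a u \<oplus> d \<odot> b u) \<in> enveloping M"

context lie_module
begin

sublocale complex_module M
  by unfold_locales

lemma enveloping_linear:
  assumes "a \<in> enveloping M"
  shows "u \<in> carrier M \<Longrightarrow> a u \<in> carrier M"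
    and "u \<in> carrier M \<Longrightarrow> v \<in> carrier M \<Longrightarrow> a (u \<oplus> v) = a u \<oplus> a v"
    and "u \<in> carrier M \<Longrightarrow> a (c \<odot> u) = c \<odot> a u"
proof -
  have "(\<forall>u\<in>carrier M. a u \<in> carrier M) \<and> (\<forall>u\<in>carrier M. \<forall>v\<in>carrier M. a (u \<oplus> v) = a u \<oplus> a v)
    \<and> (\<forall>c. \<forall>u\<in>carrier M. a (c \<odot> u) = c \<odot> a u)"
    using assms
    by induction (auto simp: act_closed act_add_right act_smult_right smult_add_right smult_smult M.a_ac mult.commute)
  then show "u \<in> carrier M \<Longrightarrow> a u \<in> carrier M"
    "u \<in> carrier M \<Longrightarrow> v \<in> carrier M \<Longrightarrow> a (u \<oplus> v) = a u \<oplus> a v"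
    "u \<in> carrier M \<Longrightarrow> a (c \<odot> u) = c \<odot> a u"
    by auto
qed

lemma submodule_if_closed:
  assumes "N \<subseteq> carrier M" "\<zero> \<in> N" "\<And>u v. u \<in> N \<Longrightarrow> v \<in> N \<Longrightarrow> u \<oplus> v \<in> N" "\<And>c u. u \<in> N \<Longrightarrow> c \<odot> u \<in> N"
  shows "submodule N complex_field M"
proof (rule M.submoduleI)
  fix a assume "a \<in> N"
  then show "\<ominus> a \<in> N" using assms(4)[of a "-1"] assms(1) smult_minus_one[of a] by auto
qed (use assms in auto)

end

context irreducible_lie_module
begin

text \<open>
  The density theorem for the embedded module, with the operators of a countable basis of the Lie
  algebra. Sums of operators are written with \<open>foldr\<close> because the addition of the module is only defined on its
  carrier.
\<close>

lemma enveloping_rank_one_and_transitive: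
  assumes "countable_dimension scale"
  shows "(\<forall>S. finite S \<longrightarrow> S \<subseteq> carrier M \<longrightarrow> (\<exists>bs. set bs \<subseteq> enveloping M
      \<and> (\<forall>b\<in>set bs. \<exists>e\<in>carrier M. \<forall>x\<in>S. \<exists>c. b x = c \<odot> e)
      \<and> (\<forall>x\<in>S. foldr (\<lambda>b y. b x \<oplus> y) bs \<zero> = x)))
    \<and> (\<forall>u\<in>carrier M. \<forall>v\<in>carrier M. u \<noteq> \<zero> \<longrightarrow> (\<exists>b\<in>enveloping M. b u = v))"
proof -
  obtain E and J :: "'u \<Rightarrow> ('u \<Rightarrow>\<^sub>0 complex)" where JE:
    "\<And>f. E f \<in> carrier M" "\<And>f g. E (f + g) = E f \<oplus> E g" "\<And>c f. E (pm_scale (*) c f) = c \<odot> E f"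
    "\<And>u. u \<in> carrier M \<Longrightarrow> E (J u) = u"
    "\<And>u v. u \<in> carrier M \<Longrightarrow> v \<in> carrier M \<Longrightarrow> J (u \<oplus> v) = J u + J v"
    "\<And>c u. u \<in> carrier M \<Longrightarrow> J (c \<odot> u) = pm_scale (*) c (J u)"
    using linear_coordinates by blast
  have E0: "E 0 = \<zero>" using JE(3)[of 0 0] JE(1)[of 0] by simp
  have J0: "J \<zero> = 0" using JE(6)[of \<zero> 0] by simp
  have J_eq_0: "u = \<zero>" if "u \<in> carrier M" "J u = 0" for u
    using JE(4)[OF that(1)] that(2) E0 by simp
  obtain B where B: "countable B" "L.span B = UNIV"
    using assms unfolding countable_dimension_def by blast
  define T where "T = (\<lambda>x f. J (act M x (E f))) ` B"
  interpret ops: irreducible_operators "pm_scale (*)" T "J ` carrier M"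
  proof (intro irreducible_operators.intro irreducible_operators_axioms.intro pm.vector_space_axioms)
    show "Vector_Spaces.linear (pm_scale (*)) (pm_scale (*)) t" if "t \<in> T" for t
      using that unfolding T_def Vector_Spaces.linear_iff
      by (auto simp: JE act_add_right act_smult_right act_closed pm.vector_space_axioms)
    show "countable T" unfolding T_def using B by blast
    show "pm.subspace (J ` carrier M)"
      by (rule pm.subspaceI) (auto simp flip: JE J0)
    show "t w \<in> J ` carrier M" if "t \<in> T" "w \<in> J ` carrier M" for t w
      using that JE(1) act_closed unfolding T_def by auto
    show "J ` carrier M \<noteq> {0}" using nonzero J_eq_0 by (auto simp: image_subset_iff)
    fix N assume N: "pm.subspace N" "N \<subseteq> J ` carrier M" "\<And>t w. t \<in> T \<Longrightarrow> w \<in> N \<Longrightarrow> t w \<in> N"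
    define N' where "N' = {u \<in> carrier M. J u \<in> N}"
    have N_eq: "N = J ` N'" using N(2) by (auto simp: N'_def)
    have "lie_submodule N' M"
      unfolding lie_submodule_def
    proof (intro conjI submodule_if_closed ballI allI)
      fix x u assume u: "u \<in> N'"
      have "x \<in> L.span B" using B by auto
      then show "act M x u \<in> N'"
      proof (induction rule: L.span_induct_alt)
        case base
        have "act M (scale 0 0) u = \<zero>" 
          using act_scale_left[of u 0 0] act_closed[of u 0] u by (simp add: N'_def)
        then show ?case by (simp add: N'_def J0 pm.subspace_0[OF N(1)])
      next
        case (step c x y)
        have "J (act M x (E (J u))) \<in> N" using N(3)[of _ "J u"] step(1) u by (auto simp: T_def N'_def)
        with step u show ?case
          by (auto simp: N'_def act_add_left act_scale_left act_closed JE
              intro!: pm.subspace_add[OF N(1)] pm.subspace_scale[OF N(1)])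
      qed
    qed (auto simp: N'_def JE J0 pm.subspace_0[OF N(1)] pm.subspace_add[OF N(1)] pm.subspace_scale[OF N(1)])
    then show "N = {0} \<or> N = J ` carrier M"
      using no_proper_submodule[of N'] N_eq J0 by auto
  qed
  have transfer: "\<exists>b\<in>enveloping M. \<forall>u\<in>carrier M. J (b u) = a (J u)" if "a \<in> ops.generated_algebra" for a
    using that
  proof induction
    case (gen t)
    then show ?case using enveloping.gen[of M] JE(4) by (fastforce simp: T_def)
  next
    case ident
    then show ?case using enveloping.ident[of M] by (intro bexI[of _ "\<lambda>u. u"]) auto
  next
    case (comp a b)
    then obtain a' b' where "a' \<in> enveloping M" "b' \<in> enveloping M"
      "\<forall>u\<in>carrier M. J (a' u) = a (J u)" "\<forall>u\<in>carrier M. J (b' u) = b (J u)" by blast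
    then show ?case
      by (intro bexI[of _ "\<lambda>u. a' (b' u)"]) (auto simp: enveloping_linear enveloping.comp)
  next
    case (lincomb a b c d)
    then obtain a' b' where "a' \<in> enveloping M" "b' \<in> enveloping M"
      "\<forall>u\<in>carrier M. J (a' u) = a (J u)" "\<forall>u\<in>carrier M. J (b' u) = b (J u)" by blast
    then show ?case
      by (intro bexI[of _ "\<lambda>u. c \<odot> a' u \<oplus> d \<odot> b' u"]) (auto simp: enveloping_linear enveloping.lincomb JE)
  qed
  then obtain \<tau> where \<tau>: "\<And>a. a \<in> ops.generated_algebra \<Longrightarrow> \<tau> a \<in> enveloping M"
    "\<And>a u. a \<in> ops.generated_algebra \<Longrightarrow> u \<in> carrier M \<Longrightarrow> J (\<tau> a u) = a (J u)" by metis
  have \<tau>E: "\<tau> a u = E (a (J u))" if "a \<in> ops.generated_algebra" "u \<in> carrier M" for a u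
    using JE(4)[of "\<tau> a u"] \<tau> that enveloping_linear(1) by metis
  show ?thesis
  proof (intro conjI allI impI ballI)
    fix S assume S: "finite S" "S \<subseteq> carrier M"
    obtain as where as: "set as \<subseteq> ops.generated_algebra"
      "\<And>a. a \<in> set as \<Longrightarrow> \<exists>e\<in>J ` carrier M. \<forall>x\<in>pm.span (J ` S). \<exists>c. a x = pm_scale (*) c e"
      "\<And>x. x \<in> pm.span (J ` S) \<Longrightarrow> (\<Sum>a\<leftarrow>as. a x) = x"
      using ops.rank_one_decomposition[OF finite_imageI[OF S(1)] image_mono[OF S(2)]] by blast
    have span: "J x \<in> pm.span (J ` S)" if "x \<in> S" for x using that by (intro pm.span_base) auto
    show "\<exists>bs. set bs \<subseteq> enveloping M
        \<and> (\<forall>b\<in>set bs. \<exists>e\<in>carrier M. \<forall>x\<in>S. \<exists>c. b x = c \<odot> e)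
        \<and> (\<forall>x\<in>S. foldr (\<lambda>b y. b x \<oplus> y) bs \<zero> = x)"
    proof (intro exI[of _ "map \<tau> as"] conjI ballI)
      show "set (map \<tau> as) \<subseteq> enveloping M" using as(1) \<tau>(1) by auto
      fix b assume "b \<in> set (map \<tau> as)"
      then obtain a where a: "a \<in> set as" "b = \<tau> a" by auto
      then obtain e where e: "e \<in> carrier M" "\<And>x. x \<in> S \<Longrightarrow> \<exists>c. a (J x) = pm_scale (*) c (J e)"
        using as(2)[OF a(1)] span by blast
      have "\<exists>c. b x = c \<odot> e" if "x \<in> S" for x
        using e(2)[OF that] a as(1) S that \<tau>E[of a x] JE(3) JE(4)[OF e(1)] by fastforce
      then show "\<exists>e\<in>carrier M. \<forall>x\<in>S. \<exists>c. b x = c \<odot> e" using e(1) by blast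
    next
      fix x assume x: "x \<in> S"
      then have xM: "x \<in> carrier M" using S by auto
      have "foldr (\<lambda>b y. b x \<oplus> y) (map \<tau> bs) \<zero> = E (\<Sum>a\<leftarrow>bs. a (J x))"
        if "set bs \<subseteq> ops.generated_algebra" for bs
        using that by (induction bs) (auto simp: E0 JE \<tau>E xM)
      then show "foldr (\<lambda>b y. b x \<oplus> y) (map \<tau> as) \<zero> = x"
        using as(1,3) span[OF x] JE(4)[OF xM] by simp
    qed
  next
    fix u v assume uv: "u \<in> carrier M" "v \<in> carrier M" "u \<noteq> \<zero>"
    then obtain a where a: "a \<in> ops.generated_algebra" "a (J u) = J v"
      using ops.algebra_transitive[of "J u" "J v"] J_eq_0 by blast
    then show "\<exists>b\<in>enveloping M. b u = v"
      using \<tau>(1)[OF a(1)] \<tau>E[OF a(1) uv(1)] JE(4)[OF uv(2)] by auto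
  qed
qed

end

section \<open>The affine Lie algebra\<close>

lemma sum_keys_superset:
  assumes "\<And>k. h k 0 = 0" "finite S" "Poly_Mapping.keys f \<subseteq> S"
  shows "(\<Sum>k\<in>Poly_Mapping.keys f. h k (Poly_Mapping.lookup f k)) = (\<Sum>k\<in>S. h k (Poly_Mapping.lookup f k))"
  by (rule sum.mono_neutral_left) (use assms in \<open>auto simp: in_keys_iff\<close>)

lemma sum_keys_add:
  fixes h :: "'k \<Rightarrow> 'b::monoid_add \<Rightarrow> 'c::ab_group_add"
  assumes h: "\<And>k x y. h k (x + y) = h k x + h k y"
  shows "(\<Sum>k\<in>Poly_Mapping.keys (f + g). h k (Poly_Mapping.lookup (f + g) k)) =
     (\<Sum>k\<in>Poly_Mapping.keys f. h k (Poly_Mapping.lookup f k)) +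
     (\<Sum>k\<in>Poly_Mapping.keys g. h k (Poly_Mapping.lookup g k))"
proof -
  have h0: "h k 0 = 0" for k
    using h[of k 0 0] by simp
  define S where "S = Poly_Mapping.keys f \<union> Poly_Mapping.keys g"
  have S: "finite S" "Poly_Mapping.keys f \<subseteq> S" "Poly_Mapping.keys g \<subseteq> S" "Poly_Mapping.keys (f + g) \<subseteq> S"
    using keys_add[of f g] by (auto simp: S_def)
  show ?thesis
    using sum_keys_superset[of h S f] sum_keys_superset[of h S g] sum_keys_superset[of h S "f + g"] h0 S
    by (simp add: lookup_add h sum.distrib)
qed

text \<open>
  Identities that are additive in each argument need only be checked on the generators.
\<close>

lemma affine_induct [case_names loop central add]:
  fixes p :: "'g::comm_monoid_add affine"
  assumes loop: "\<And>a n. P (loop a n)" and central: "\<And>c. P (0, c)"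
    and add: "\<And>p q. P p \<Longrightarrow> P q \<Longrightarrow> P (p + q)"
  shows "P p"
proof -
  have "P (f, 0)" for f :: "int \<Rightarrow>\<^sub>0 'g"
  proof (induction f rule: update_induct)
    case const
    then show ?case using central[of 0] by simp
  next
    case (update f n a)
    have "Poly_Mapping.update n a f = f + Poly_Mapping.single n a"
      using update by (intro poly_mapping_eqI) (auto simp: lookup_update lookup_add lookup_single in_keys_iff when_def)
    then show ?case using add[OF update(3) loop[of a n]] by (simp add: loop_def)
  qed
  from add[OF this[of "fst p"] central[of "snd p"]] show ?thesis by simp
qed

context lie_algebra
begin

lemma bracket_simps: "bracket (x + y) z = bracket x z + bracket y z"
  "bracket x (y + z) = bracket x y + bracket x z"
  "bracket (scale c x) y = scale c (bracket x y)"
  "bracket x (scale c y) = scale c (bracket x y)"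
  using bracket_linear_left bracket_linear_right unfolding Vector_Spaces.linear_iff by blast+

lemma bracket_swap: "bracket y x = - bracket x y"
proof -
  have "bracket x y + bracket y x = 0"
    using bracket_self[of "x + y"] unfolding bracket_simps by (simp add: bracket_self add.commute)
  then show ?thesis by (simp add: eq_neg_iff_add_eq_0 add.commute)
qed

lemma vector_space_affine_scale: "vector_space (affine_scale scale)"
proof -
  interpret pmg: vector_space "pm_scale scale :: _ \<Rightarrow> (int \<Rightarrow>\<^sub>0 'g) \<Rightarrow> _"
    by (rule vector_space_pm_scale[OF vector_space_axioms])
  show ?thesis
  proof (rule vector_space.intro)
    show "affine_scale scale a (x + y) = affine_scale scale a x + affine_scale scale a y" for a x y
      by (simp add: affine_scale_def pmg.scale_right_distrib distrib_left)
    show "affine_scale scale (a + b) x = affine_scale scale a x + affine_scale scale b x" for a b x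
      by (simp add: affine_scale_def pmg.scale_left_distrib distrib_right)
    show "affine_scale scale a (affine_scale scale b x) = affine_scale scale (a * b) x" for a b x
      by (simp add: affine_scale_def)
    show "affine_scale scale 1 x = x" for x
      by (simp add: affine_scale_def)
  qed
qed

end

context lie_algebra_form
begin

lemma form_simps: "form (x + y) z = form x z + form y z"
  "form x (y + z) = form x y + form x z"
  "form (scale c x) y = c * form x y"
  "form x (scale c y) = c * form x y"
  using form_linear_left form_linear_right unfolding Vector_Spaces.linear_iff by blast+

abbreviation "B \<equiv> affine_bracket bracket form"

text \<open>
  The bracket of \<open>a \<otimes> t\<^sup>m\<close> and \<open>b \<otimes> t\<^sup>n\<close>.
\<close>

definition loop_bracket :: "int \<Rightarrow> int \<Rightarrow> 'g \<Rightarrow> 'g \<Rightarrow> 'g affine" where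
  "loop_bracket m n a b =
     (Poly_Mapping.single (m + n) (bracket a b), of_int m * form a b * (if m + n = 0 then 1 else 0))"

lemma affine_bracket_sum:
  "B p q = (\<Sum>m\<in>Poly_Mapping.keys (fst p). \<Sum>n\<in>Poly_Mapping.keys (fst q).
      loop_bracket m n (Poly_Mapping.lookup (fst p) m) (Poly_Mapping.lookup (fst q) n))"
  by (simp add: affine_bracket_def loop_bracket_def Let_def)

lemma pm_scale_single_scale:
  "pm_scale scale c (Poly_Mapping.single n a) = Poly_Mapping.single n (scale c a)"
  by (rule poly_mapping_eqI) (simp add: lookup_pm_scale[OF vector_space_axioms] lookup_single when_def)

lemma loop_bracket_simps:
  "loop_bracket m n (a + a') b = loop_bracket m n a b + loop_bracket m n a' b"
  "loop_bracket m n a (b + b') = loop_bracket m n a b + loop_bracket m n a b'"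
  "loop_bracket m n (scale c a) b = affine_scale scale c (loop_bracket m n a b)"
  "loop_bracket m n a (scale c b) = affine_scale scale c (loop_bracket m n a b)"
  "loop_bracket m n 0 b = 0" "loop_bracket m n a 0 = 0"
  by (simp_all add: loop_bracket_def bracket_simps form_simps single_add affine_scale_def
      pm_scale_single_scale distrib_left distrib_right zero_prod_def)

lemma affine_bracket_add:
  "B (p + p') q = B p q + B p' q" "B p (q + q') = B p q + B p q'"
proof -
  show "B (p + p') q = B p q + B p' q"
    unfolding affine_bracket_sum fst_add
    by (rule sum_keys_add[of "\<lambda>m a. \<Sum>n\<in>Poly_Mapping.keys (fst q). loop_bracket m n a (Poly_Mapping.lookup (fst q) n)"])
      (simp add: loop_bracket_simps sum.distrib)
  show "B p (q + q') = B p q + B p q'"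
    unfolding affine_bracket_sum fst_add sum.distrib[symmetric]
    by (intro sum.cong refl sum_keys_add loop_bracket_simps)
qed

lemma affine_bracket_scale:
  "B (affine_scale scale c p) q = affine_scale scale c (B p q)"
  "B p (affine_scale scale c q) = affine_scale scale c (B p q)"
proof -
  interpret aff: vector_space "affine_scale scale" by (rule vector_space_affine_scale)
  note lk = lookup_pm_scale[OF vector_space_axioms]
  have keys: "Poly_Mapping.keys (pm_scale scale c f) \<subseteq> Poly_Mapping.keys f" for f
    by (auto simp: in_keys_iff lk)
  show "B (affine_scale scale c p) q = affine_scale scale c (B p q)"
    unfolding affine_bracket_sum affine_scale_def[of _ _ p] fst_conv
    by (subst sum_keys_superset[OF _ _ keys, where h = "\<lambda>m a. \<Sum>n\<in>Poly_Mapping.keys (fst q). loop_bracket m n a (Poly_Mapping.lookup (fst q) n)"])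
      (simp_all add: loop_bracket_simps lk aff.scale_sum_right)
  show "B p (affine_scale scale c q) = affine_scale scale c (B p q)"
    unfolding affine_bracket_sum affine_scale_def[of _ _ q] fst_conv aff.scale_sum_right
  proof (rule sum.cong[OF refl])
    fix m
    show "(\<Sum>n\<in>Poly_Mapping.keys (pm_scale scale c (fst q)). loop_bracket m n (Poly_Mapping.lookup (fst p) m)
          (Poly_Mapping.lookup (pm_scale scale c (fst q)) n)) =
        (\<Sum>n\<in>Poly_Mapping.keys (fst q). affine_scale scale c
          (loop_bracket m n (Poly_Mapping.lookup (fst p) m) (Poly_Mapping.lookup (fst q) n)))"
      by (subst sum_keys_superset[OF _ _ keys]) (simp_all add: loop_bracket_simps lk)
  qed
qed

lemma affine_bracket_central_part [simp]: "B (0, c) q = 0" "B p (0, c) = 0"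
  by (simp_all add: affine_bracket_def)

lemma affine_bracket_loops: 
  "B (loop a m) (Poly_Mapping.single n b, c) = loop_bracket m n a b"
  by (cases "a = 0"; cases "b = 0") (auto simp: affine_bracket_sum loop_def loop_bracket_simps)

lemma affine_bracket_loop_loop: "B (loop a m) (loop b n) = loop_bracket m n a b"
  unfolding loop_def[of b n] by (rule affine_bracket_loops)

lemma affine_bracket_swap: "B q p = - B p q"
proof -
  define S where "S p q = B p q + B q p" for p q
  have add: "S (p + p') q = S p q + S p' q" "S p (q + q') = S p q + S p q'" for p p' q q'
    by (simp_all add: S_def affine_bracket_add ac_simps)
  have central: "S (0, c) q = 0" "S p (0, c) = 0" for c p q
    by (simp_all add: S_def)
  have loops: "S (loop a m) (loop b n) = 0" for a b m n
  proof -
    have "of_int m * t + of_int n * t = 0" if "m + n = 0" for t :: complex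
      using that by (simp flip: distrib_right of_int_add)
    then show ?thesis
      by (simp add: S_def affine_bracket_loop_loop)
        (simp add: loop_bracket_def bracket_swap[of a b] form_symmetric[of b a] add.commute[of n m]
          zero_prod_def flip: single_add)
  qed
  have "S p q = 0"
  proof (induction p rule: affine_induct)
    case (loop a m)
    show ?case by (induction q rule: affine_induct) (simp_all add: loops central add)
  qed (simp_all add: central add)
  then show ?thesis by (simp add: S_def eq_neg_iff_add_eq_0 add.commute)
qed

text \<open>
  On generators the central parts are \<open>k\<close>, \<open>l\<close> and \<open>m\<close> times the same number, because the form is invariant and
  symmetric, and they only occur when \<open>k + l + m = 0\<close>.
\<close>

lemma affine_jacobi: "B p (B q r) + B q (B r p) + B r (B p q) = 0"
proof -
  define S where "S p q r = B p (B q r) + B q (B r p) + B r (B p q)" for p q r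
  have add: "S (p + p') q r = S p q r + S p' q r" "S p (q + q') r = S p q r + S p q' r"
    "S p q (r + r') = S p q r + S p q r'" for p p' q q' r r'
    by (simp_all add: S_def affine_bracket_add ac_simps)
  have central: "S (0, c) q r = 0" "S p (0, c) r = 0" "S p q (0, c) = 0" for c p q r
    using affine_bracket_add(1)[of 0 0] affine_bracket_add(2)[of _ 0 0] by (simp_all add: S_def)
  have loops: "S (loop a k) (loop b l) (loop c m) = 0" for a b c k l m
  proof -
    have form: "form b (bracket c a) = form a (bracket b c)" "form c (bracket a b) = form a (bracket b c)"
      using form_invariant[of b c a] form_invariant[of a b c] form_symmetric by simp_all
    have sum: "of_int k * t + of_int l * t + of_int m * t = 0" if "k + (l + m) = 0" for t :: complex
      using that by (simp add: add.assoc flip: distrib_right of_int_add)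
    have nested: "B (loop a k) (loop_bracket l m b c) = loop_bracket k (l + m) a (bracket b c)" for a b c k l m
      unfolding loop_bracket_def[of l m] by (rule affine_bracket_loops)
    have S: "S (loop a k) (loop b l) (loop c m) =
        loop_bracket k (l + m) a (bracket b c) + loop_bracket l (m + k) b (bracket c a) + loop_bracket m (k + l) c (bracket a b)"
      by (simp add: S_def affine_bracket_loop_loop nested)
    have index: "l + (m + k) = k + (l + m)" "m + (k + l) = k + (l + m)" by simp_all
    show ?thesis
      using sum[of "form a (bracket b c)"]
      unfolding S loop_bracket_def index form
      by (simp add: zero_prod_def jacobi flip: single_add)
  qed
  have "S p q r = 0"
  proof (induction p rule: affine_induct)
    case (loop a k)
    show ?case
    proof (induction q rule: affine_induct)
      case (loop b l)
      show ?case by (induction r rule: affine_induct) (simp_all add: loops central add)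
    qed (simp_all add: central add)
  qed (simp_all add: central add)
  then show ?thesis by (simp add: S_def)
qed

lemma lie_algebra_affine: "lie_algebra (affine_scale scale) B"
proof -
  interpret aff: vector_space "affine_scale scale" by (rule vector_space_affine_scale)
  have self: "B x x = 0" for x
  proof -
    have "affine_scale scale (1 + 1) (B x x) = 0"
      using affine_bracket_swap[of x x] unfolding aff.scale_left_distrib aff.scale_one
      by (simp add: eq_neg_iff_add_eq_0)
    then show ?thesis by (simp del: one_add_one)
  qed
  show ?thesis
    by unfold_locales (simp_all add: affine_bracket_add affine_bracket_scale affine_jacobi self)
qed

end

section \<open>Evaluation modules\<close>

lemma evaluation_module_simps [simp]:
  "carrier (evaluation_module U z) = carrier U" "\<zero>\<^bsub>evaluation_module U z\<^esub> = \<zero>\<^bsub>U\<^esub>"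
  "x \<oplus>\<^bsub>evaluation_module U z\<^esub> y = x \<oplus>\<^bsub>U\<^esub> y" "c \<odot>\<^bsub>evaluation_module U z\<^esub> x = c \<odot>\<^bsub>U\<^esub> x"
  by (simp_all add: evaluation_module_def)

context lie_module
begin

lemma act_zero_left: "u \<in> carrier M \<Longrightarrow> act M 0 u = \<zero>"
  using act_scale_left[of u 0 0] act_closed[of u 0] by simp

abbreviation "ev z \<equiv> act (evaluation_module M z)"

lemma ev_def: "ev z p u = (\<Oplus>n\<in>Poly_Mapping.keys (fst p). (z powi n) \<odot> act M (Poly_Mapping.lookup (fst p) n) u)"
  by (simp add: evaluation_module_def)

lemma ev_closed: "u \<in> carrier M \<Longrightarrow> ev z p u \<in> carrier M"
  unfolding ev_def by (intro M.finsum_closed) (auto simp: act_closed)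

lemma ev_add_left: 
  assumes u: "u \<in> carrier M"
  shows "ev z (p + q) u = ev z p u \<oplus> ev z q u"
proof -
  define h where "h n a = (z powi n) \<odot> act M a u" for n a
  show ?thesis
    unfolding ev_def fst_add h_def[symmetric]
    by (rule M.finsum_keys_add) (auto simp: h_def u act_closed act_add_left smult_add_right)
qed

lemma ev_scale_left:
  assumes u: "u \<in> carrier M"
  shows "ev z (affine_scale scale c p) u = c \<odot> ev z p u"
proof -
  define h where "h n a = (z powi n) \<odot> act M a u" for n a
  note lk = lookup_pm_scale[OF L.vector_space_axioms]
  have h: "h n a \<in> carrier M" "h n 0 = \<zero>" for n a
    by (auto simp: h_def u act_closed act_zero_left)
  have "ev z (affine_scale scale c p) u = (\<Oplus>n\<in>Poly_Mapping.keys (fst p). h n (Poly_Mapping.lookup (pm_scale scale c (fst p)) n))"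
    unfolding ev_def affine_scale_def fst_conv h_def[symmetric]
    by (rule M.finsum_keys_superset) (auto simp: h in_keys_iff lk)
  also have "\<dots> = (\<Oplus>n\<in>Poly_Mapping.keys (fst p). c \<odot> h n (Poly_Mapping.lookup (fst p) n))"
    by (simp add: h_def lk u act_scale_left act_closed smult_smult mult.commute)
  also have "\<dots> = c \<odot> ev z p u"
    unfolding ev_def h_def[symmetric] by (subst M.finsum_smult_ldistr) (auto simp: h)
  finally show ?thesis .
qed

lemma ev_add_right:
  assumes "u \<in> carrier M" "v \<in> carrier M"
  shows "ev z p (u \<oplus> v) = ev z p u \<oplus> ev z p v"
  unfolding ev_def using assms
  by (subst M.finsum_addf[symmetric]) (auto simp: act_closed act_add_right smult_add_right)

lemma ev_smult_right:
  assumes "u \<in> carrier M"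
  shows "ev z p (c \<odot> u) = c \<odot> ev z p u"
  unfolding ev_def using assms
  by (subst M.finsum_smult_ldistr) (auto simp: act_closed act_smult_right smult_smult mult.commute)

lemma ev_central: "ev z (0, c) u = \<zero>"
  by (simp add: ev_def)

text \<open>
  Both sides are biadditive in \<open>p\<close> and \<open>q\<close>. On loops this is \<open>z\<^sup>m\<^sup>+\<^sup>n = z\<^sup>m z\<^sup>n\<close>, which for negative exponents requires
  \<open>z \<noteq> 0\<close>; the central term acts by zero.
\<close>

lemma ev_bracket:
  assumes "lie_algebra_form scale bracket form" and z: "z \<noteq> 0" and u: "u \<in> carrier M"
  shows "ev z (affine_bracket bracket form p q) u = ev z p (ev z q u) \<ominus> ev z q (ev z p u)"
proof -
  interpret F: lie_algebra_form scale bracket form by fact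
  have zero: "ev z p \<zero> = \<zero>" for p
    using ev_smult_right[of \<zero> z p 0] ev_closed[of \<zero> z p] by simp
  have zero': "ev z 0 u = \<zero>" 
    using ev_central[of z 0 u] by (simp add: zero_prod_def)
  have rearrange: "(a \<ominus> b) \<oplus> (c \<ominus> d) = (a \<oplus> c) \<ominus> (b \<oplus> d)"
    if "a \<in> carrier M" "b \<in> carrier M" "c \<in> carrier M" "d \<in> carrier M" for a b c d
    using that by (simp add: a_minus_def M.minus_add M.a_ac)
  show ?thesis
  proof (induction p rule: affine_induct)
    case (loop a m)
    show ?case
    proof (induction q rule: affine_induct)
      case (loop b n)
      have "F.B (loop a m) (loop b n) = loop (bracket a b) (m + n) + (0, of_int m * form a b * (if m + n = 0 then 1 else 0))"
        using F.affine_bracket_loops[of a m n b 0] by (simp add: F.loop_bracket_def loop_def)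
      then have "ev z (F.B (loop a m) (loop b n)) u = z powi (m + n) \<odot> act M (bracket a b) u"
        using u by (simp add: ev_add_left ev_central evaluation_loop act_closed)
      also have "\<dots> = (z powi (m + n)) \<odot> act M a (act M b u) \<ominus> (z powi (m + n)) \<odot> act M b (act M a u)"
        using u by (simp add: act_bracket act_closed a_minus_def smult_add_right flip: smult_minus_one)
          (simp add: smult_smult act_closed mult.commute)
      also have "\<dots> = ev z (loop a m) (ev z (loop b n) u) \<ominus> ev z (loop b n) (ev z (loop a m) u)"
        using u z by (simp add: evaluation_loop act_closed act_smult_right smult_smult power_int_add mult.commute)
      finally show ?case .
    next
      case (central c)
      then show ?case using u by (simp add: ev_central zero zero' a_minus_def flip: smult_minus_one)
    next
      case (add p q)
      then show ?case using u
        by (simp add: F.affine_bracket_add ev_add_left ev_add_right ev_closed rearrange)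
    qed
  next
    case (central c)
    then show ?case using u by (simp add: ev_central zero zero' a_minus_def flip: smult_minus_one)
  next
    case (add p q)
    then show ?case using u
      by (simp add: F.affine_bracket_add ev_add_left ev_add_right ev_closed rearrange)
  qed
qed

lemma lie_module_evaluation:
  assumes form: "lie_algebra_form scale bracket form" and z: "z \<noteq> 0"
  shows "lie_module (affine_scale scale) (affine_bracket bracket form) (evaluation_module M z)"
proof (rule lie_module.intro)
  interpret F: lie_algebra_form scale bracket form by fact
  show "lie_algebra (affine_scale scale) F.B" by (rule F.lie_algebra_affine)
  have ag: "abelian_group (evaluation_module M z)"
  proof (rule abelian_groupI)
    fix x assume "x \<in> carrier (evaluation_module M z)"
    then show "\<exists>y\<in>carrier (evaluation_module M z). y \<oplus>\<^bsub>evaluation_module M z\<^esub> x = \<zero>\<^bsub>evaluation_module M z\<^esub>"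
      by (intro bexI[of _ "\<ominus> x"]) (auto simp: M.l_neg)
  qed (auto simp: M.a_ac)
  show "Module.module complex_field (evaluation_module M z)"
    by (rule Module.moduleI[OF M.R.is_cring ag]) (auto simp: smult_add_left smult_add_right smult_smult)
  interpret E: abelian_group "evaluation_module M z" by (rule ag)
  have minus: "x \<ominus>\<^bsub>evaluation_module M z\<^esub> y = x \<ominus> y" if "x \<in> carrier M" "y \<in> carrier M" for x y
  proof -
    have "\<ominus>\<^bsub>evaluation_module M z\<^esub> y = \<ominus> y"
      using that by (intro E.minus_equality) (auto simp: M.l_neg)
    then show ?thesis by (simp add: a_minus_def)
  qed
  show "lie_module_axioms (affine_scale scale) F.B (evaluation_module M z)"
    by unfold_locales
      (auto simp: ev_closed ev_add_left ev_scale_left ev_add_right ev_smult_right ev_bracket[OF form z] minus)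
qed

end

section \<open>Operators on one factor of the free tensor space\<close>

lemma poly_mapping_keys_induct [consumes 1, case_names zero add]:
  fixes f :: "'k \<Rightarrow>\<^sub>0 'b::comm_monoid_add"
  assumes "Poly_Mapping.keys f \<subseteq> A" "P 0"
    and "\<And>f u c. u \<in> A \<Longrightarrow> Poly_Mapping.keys f \<subseteq> A \<Longrightarrow> P f \<Longrightarrow> P (f + Poly_Mapping.single u c)"
  shows "P f"
  using assms(1)
proof (induction f rule: update_induct)
  case const
  show ?case by (fact assms(2))
next
  case (update f u c)
  have "Poly_Mapping.update u c f = f + Poly_Mapping.single u c"
    using update by (intro poly_mapping_eqI) (auto simp: lookup_update lookup_add lookup_single in_keys_iff when_def)
  moreover have "u \<in> A" "Poly_Mapping.keys f \<subseteq> A" using update by (auto simp: keys_update)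
  ultimately show ?case using assms(3) update by simp
qed

text \<open>
  The operator \<open>1 \<otimes> \<dots> \<otimes> a \<otimes> \<dots> \<otimes> 1\<close> with \<open>a\<close> at position \<open>i\<close>. It is defined for every function \<open>a\<close>; it
  preserves the relations of multilinearity when \<open>a\<close> is linear.
\<close>

definition slot :: "'i \<Rightarrow> ('u \<Rightarrow> 'u) \<Rightarrow> (('i \<Rightarrow> 'u) \<Rightarrow>\<^sub>0 complex) \<Rightarrow> (('i \<Rightarrow> 'u) \<Rightarrow>\<^sub>0 complex)" where
  "slot i a f = (\<Sum>u\<in>Poly_Mapping.keys f. Poly_Mapping.single (u(i := a (u i))) (Poly_Mapping.lookup f u))"

lemma slot_add: "slot i a (f + g) = slot i a f + slot i a g"
  unfolding slot_def by (rule sum_keys_add) (simp add: single_add)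

lemma slot_single [simp]: "slot i a (Poly_Mapping.single u c) = Poly_Mapping.single (u(i := a (u i))) c"
  by (simp add: slot_def)

lemma slot_zero [simp]: "slot i a 0 = 0"
  by (simp add: slot_def)

lemma slot_scale: "slot i a (pm_scale (*) c f) = pm_scale (*) c (slot i a f)"
  by (induction f rule: poly_mapping_keys_induct[OF subset_UNIV])
    (simp_all add: slot_add pm.scale_right_distrib)

lemma slot_diff: "slot i a (f - g) = slot i a f - slot i a g"
  using slot_add[of i a "f - g" g] by (simp add: eq_diff_eq)

lemma slot_sum: "slot i a (sum f A) = (\<Sum>x\<in>A. slot i a (f x))"
  by (induction A rule: infinite_finite_induct) (simp_all add: slot_add)

lemma slot_compose: "slot i a (slot i b f) = slot i (\<lambda>x. a (b x)) f"
  by (induction f rule: poly_mapping_keys_induct[OF subset_UNIV]) (simp_all add: slot_add)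

lemma slot_commute: "i \<noteq> j \<Longrightarrow> slot i a (slot j b f) = slot j b (slot i a f)"
  by (induction f rule: poly_mapping_keys_induct[OF subset_UNIV]) (simp_all add: slot_add fun_upd_twist)

lemma slot_cong: "(\<And>u. u \<in> Poly_Mapping.keys f \<Longrightarrow> a (u i) = b (u i)) \<Longrightarrow> slot i a f = slot i b f"
  unfolding slot_def by (intro sum.cong) auto

lemma slot_ident [simp]: "slot i (\<lambda>x. x) f = f"
  by (induction f rule: poly_mapping_keys_induct[OF subset_UNIV]) (simp_all add: slot_add)

lemma free_tensor_act: "act (free_tensor I V) x f = (\<Sum>i\<in>I. slot i (act (V i) x) f)"
  unfolding free_tensor_def slot_def by (simp add: sum.swap[of _ I])

locale tensor_family = L: lie_algebra scale bracket
  for scale :: "complex \<Rightarrow> 'g::ab_group_add \<Rightarrow> 'g" and bracket :: "'g \<Rightarrow> 'g \<Rightarrow> 'g" +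
  fixes I :: "'i set" and V :: "'i \<Rightarrow> ('g, 'u) lie_module"
  assumes finite_I: "finite I"
    and factor: "i \<in> I \<Longrightarrow> lie_module scale bracket (V i)"
begin

definition tensor_space :: "(('i \<Rightarrow> 'u) \<Rightarrow>\<^sub>0 complex) set" where
  "tensor_space = {f. Poly_Mapping.keys f \<subseteq> tuples I V}"

abbreviation "F \<equiv> tensor_space"
abbreviation "R \<equiv> tensor_relations I V"

lemma tuples_update [simp]:
  "u \<in> tuples I V \<Longrightarrow> i \<in> I \<Longrightarrow> x \<in> carrier (V i) \<Longrightarrow> u(i := x) \<in> tuples I V"
  by (auto simp: PiE_iff extensional_def)

lemma tuples_component [simp]: "u \<in> tuples I V \<Longrightarrow> i \<in> I \<Longrightarrow> u i \<in> carrier (V i)"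
  by auto

lemma single_in_F: "u \<in> tuples I V \<Longrightarrow> Poly_Mapping.single u c \<in> F"
  by (auto simp: tensor_space_def)

lemma subspace_F: "pm.subspace F"
proof (rule pm.subspaceI)
  show "f + g \<in> F" if "f \<in> F" "g \<in> F" for f g
    using that keys_add[of f g] unfolding tensor_space_def by blast
  show "pm_scale (*) c f \<in> F" if "f \<in> F" for c f
    using that by (auto simp: tensor_space_def in_keys_iff simp del: PiE_iff)
qed (simp add: tensor_space_def)

lemma F_induct [consumes 1, case_names zero add]:
  assumes "f \<in> F" "P 0"
    "\<And>f u c. u \<in> tuples I V \<Longrightarrow> f \<in> F \<Longrightarrow> P f \<Longrightarrow> P (f + Poly_Mapping.single u c)"
  shows "P f"
  using assms(1) unfolding tensor_space_def mem_Collect_eq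
  by (induction f rule: poly_mapping_keys_induct) (use assms(2,3) in \<open>auto simp: tensor_space_def\<close>)

lemma slot_F: 
  assumes "f \<in> F" "i \<in> I" "\<And>x. x \<in> carrier (V i) \<Longrightarrow> a x \<in> carrier (V i)"
  shows "slot i a f \<in> F"
  using assms(1)
  by (induction rule: F_induct)
    (use assms(2,3) in \<open>auto simp: slot_add intro!: pm.subspace_add[OF subspace_F] pm.subspace_0[OF subspace_F] single_in_F\<close>)

lemma subspace_R: "pm.subspace R"
  unfolding tensor_relations_def by (rule pm.subspace_span)

lemmas R_closed = pm.subspace_0[OF subspace_R] pm.subspace_add[OF subspace_R]
  pm.subspace_scale[OF subspace_R] pm.subspace_diff[OF subspace_R] pm.subspace_sum[OF subspace_R]

lemmas F_closed = pm.subspace_0[OF subspace_F] pm.subspace_add[OF subspace_F]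
  pm.subspace_scale[OF subspace_F] pm.subspace_diff[OF subspace_F] pm.subspace_sum[OF subspace_F]

lemma R_induct [consumes 1, case_names subspace add smult]:
  assumes "f \<in> R" "pm.subspace {f. P f}"
    "\<And>u i a b. u \<in> tuples I V \<Longrightarrow> i \<in> I \<Longrightarrow> a \<in> carrier (V i) \<Longrightarrow> b \<in> carrier (V i) \<Longrightarrow>
      P (Poly_Mapping.single (u(i := a \<oplus>\<^bsub>V i\<^esub> b)) 1
         - Poly_Mapping.single (u(i := a)) 1 - Poly_Mapping.single (u(i := b)) 1)"
    "\<And>u i c a. u \<in> tuples I V \<Longrightarrow> i \<in> I \<Longrightarrow> a \<in> carrier (V i) \<Longrightarrow>
      P (Poly_Mapping.single (u(i := c \<odot>\<^bsub>V i\<^esub> a)) 1 - Poly_Mapping.single (u(i := a)) c)"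
  shows "P f"
proof -
  have "R \<subseteq> {f. P f}"
    unfolding tensor_relations_def by (rule pm.span_minimal) (use assms in auto)
  then show ?thesis using assms(1) by auto
qed

text \<open>
  The defining relations, multiplied by a scalar.
\<close>

lemma R_add:
  assumes "u \<in> tuples I V" "i \<in> I" "a \<in> carrier (V i)" "b \<in> carrier (V i)"
  shows "Poly_Mapping.single (u(i := a \<oplus>\<^bsub>V i\<^esub> b)) c
         - Poly_Mapping.single (u(i := a)) c - Poly_Mapping.single (u(i := b)) c \<in> R"
proof -
  have "Poly_Mapping.single (u(i := a \<oplus>\<^bsub>V i\<^esub> b)) 1
         - Poly_Mapping.single (u(i := a)) 1 - Poly_Mapping.single (u(i := b)) 1 \<in> R"
    unfolding tensor_relations_def by (rule pm.span_base) (use assms in blast)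
  from R_closed(3)[OF this, of c] show ?thesis by (simp add: pm.scale_right_diff_distrib)
qed

lemma R_smult:
  assumes "u \<in> tuples I V" "i \<in> I" "a \<in> carrier (V i)"
  shows "Poly_Mapping.single (u(i := c \<odot>\<^bsub>V i\<^esub> a)) d - Poly_Mapping.single (u(i := a)) (c * d) \<in> R"
proof -
  have "Poly_Mapping.single (u(i := c \<odot>\<^bsub>V i\<^esub> a)) 1 - Poly_Mapping.single (u(i := a)) c \<in> R"
    unfolding tensor_relations_def by (rule pm.span_base) (use assms in blast)
  from R_closed(3)[OF this, of d] show ?thesis by (simp add: pm.scale_right_diff_distrib mult.commute)
qed

lemma R_subset_F: "R \<subseteq> F"
proof
  fix f assume "f \<in> R"
  then show "f \<in> F"
  proof (induction rule: R_induct)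
    case subspace
    then show ?case using subspace_F by simp
  next
    case (add u i a b)
    interpret lie_module scale bracket "V i" using add by (intro factor)
    show ?case using add by (intro F_closed single_in_F tuples_update) auto
  next
    case (smult u i c a)
    interpret lie_module scale bracket "V i" using smult by (intro factor)
    show ?case using smult by (intro F_closed single_in_F tuples_update) auto
  qed
qed

lemma slot_lincomb:
  assumes f: "f \<in> F" and i: "i \<in> I"
    and a: "\<And>x. x \<in> carrier (V i) \<Longrightarrow> a x \<in> carrier (V i)"
    and b: "\<And>x. x \<in> carrier (V i) \<Longrightarrow> b x \<in> carrier (V i)"
  shows "slot i (\<lambda>x. c \<odot>\<^bsub>V i\<^esub> a x \<oplus>\<^bsub>V i\<^esub> d \<odot>\<^bsub>V i\<^esub> b x) f
      - (pm_scale (*) c (slot i a f) + pm_scale (*) d (slot i b f)) \<in> R"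
  using f
proof (induction rule: F_induct)
  case zero
  then show ?case by (simp add: R_closed)
next
  case (add f u e)
  interpret lie_module scale bracket "V i" using i by (intro factor)
  have ui: "u i \<in> carrier (V i)" using add i by simp
  let ?s = "\<lambda>x e. Poly_Mapping.single (u(i := x)) e"
  have "(?s (c \<odot>\<^bsub>V i\<^esub> a (u i) \<oplus>\<^bsub>V i\<^esub> d \<odot>\<^bsub>V i\<^esub> b (u i)) e - ?s (c \<odot>\<^bsub>V i\<^esub> a (u i)) e - ?s (d \<odot>\<^bsub>V i\<^esub> b (u i)) e)
     + (?s (c \<odot>\<^bsub>V i\<^esub> a (u i)) e - ?s (a (u i)) (c * e)) + (?s (d \<odot>\<^bsub>V i\<^esub> b (u i)) e - ?s (b (u i)) (d * e)) \<in> R"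
    using add i a b ui by (intro R_closed R_add R_smult) auto
  from R_closed(2)[OF this add(3)] show ?case
    by (simp add: slot_add pm.scale_right_distrib algebra_simps)
qed

lemma slot_add_fun:
  assumes f: "f \<in> F" and i: "i \<in> I"
    and a: "\<And>x. x \<in> carrier (V i) \<Longrightarrow> a x \<in> carrier (V i)"
    and b: "\<And>x. x \<in> carrier (V i) \<Longrightarrow> b x \<in> carrier (V i)"
  shows "slot i (\<lambda>x. a x \<oplus>\<^bsub>V i\<^esub> b x) f - (slot i a f + slot i b f) \<in> R"
proof -
  interpret lie_module scale bracket "V i" using i by (intro factor)
  have "slot i (\<lambda>x. a x \<oplus>\<^bsub>V i\<^esub> b x) f = slot i (\<lambda>x. 1 \<odot>\<^bsub>V i\<^esub> a x \<oplus>\<^bsub>V i\<^esub> 1 \<odot>\<^bsub>V i\<^esub> b x) f"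
    using f i a b by (intro slot_cong) (auto simp: tensor_space_def subset_iff)
  then show ?thesis using slot_lincomb[OF f i, of a b 1 1] a b by simp
qed

lemma slot_smult_fun:
  assumes f: "f \<in> F" and i: "i \<in> I"
    and a: "\<And>x. x \<in> carrier (V i) \<Longrightarrow> a x \<in> carrier (V i)"
  shows "slot i (\<lambda>x. c \<odot>\<^bsub>V i\<^esub> a x) f - pm_scale (*) c (slot i a f) \<in> R"
proof -
  interpret lie_module scale bracket "V i" using i by (intro factor)
  have "slot i (\<lambda>x. c \<odot>\<^bsub>V i\<^esub> a x) f = slot i (\<lambda>x. c \<odot>\<^bsub>V i\<^esub> a x \<oplus>\<^bsub>V i\<^esub> 0 \<odot>\<^bsub>V i\<^esub> a x) f"
    using f i a by (intro slot_cong) (auto simp: tensor_space_def subset_iff)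
  then show ?thesis using slot_lincomb[OF f i, of a a c 0] a by simp
qed

lemma slot_R:
  assumes f: "f \<in> R" and i: "i \<in> I"
    and a: "\<And>x. x \<in> carrier (V i) \<Longrightarrow> a x \<in> carrier (V i)"
      "\<And>x y. x \<in> carrier (V i) \<Longrightarrow> y \<in> carrier (V i) \<Longrightarrow> a (x \<oplus>\<^bsub>V i\<^esub> y) = a x \<oplus>\<^bsub>V i\<^esub> a y"
      "\<And>c x. x \<in> carrier (V i) \<Longrightarrow> a (c \<odot>\<^bsub>V i\<^esub> x) = c \<odot>\<^bsub>V i\<^esub> a x"
  shows "slot i a f \<in> R"
  using f
proof (induction rule: R_induct)
  case subspace
  show ?case by (rule pm.subspaceI) (auto simp: slot_add slot_scale R_closed)
next
  case (add u j x y)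
  show ?case
  proof (cases "j = i")
    case True
    then show ?thesis using R_add[of u i "a x" "a y" 1] add a by (simp add: slot_diff)
  next
    case False
    then show ?thesis using R_add[of "u(i := a (u i))" j x y 1] add a i
      by (simp add: slot_diff fun_upd_twist)
  qed
next
  case (smult u j c x)
  show ?case
  proof (cases "j = i")
    case True
    then show ?thesis using R_smult[of u i "a x" c 1] smult a by (simp add: slot_diff)
  next
    case False
    then show ?thesis using R_smult[of "u(i := a (u i))" j x c 1] smult a i
      by (simp add: slot_diff fun_upd_twist)
  qed
qed

text \<open>
  A product of linear functionals, one on each factor, is a linear functional on the free tensor
  space that vanishes on all relations. Choosing functionals that take the value \<open>1\<close> at the components of \<open>w\<close>
  separates \<open>w\<close> from zero.
\<close>

lemma single_notin_R:
  assumes w: "w \<in> tuples I V" "\<And>i. i \<in> I \<Longrightarrow> w i \<noteq> \<zero>\<^bsub>V i\<^esub>"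
  shows "Poly_Mapping.single w 1 \<notin> R"
proof -
  have "\<exists>\<phi> :: 'u \<Rightarrow> complex. \<phi> (w i) = 1 \<and>
      (\<forall>x\<in>carrier (V i). \<forall>y\<in>carrier (V i). \<phi> (x \<oplus>\<^bsub>V i\<^esub> y) = \<phi> x + \<phi> y) \<and>
      (\<forall>c. \<forall>x\<in>carrier (V i). \<phi> (c \<odot>\<^bsub>V i\<^esub> x) = c * \<phi> x)" if i: "i \<in> I" for i
  proof -
    interpret lie_module scale bracket "V i" using i by (intro factor)
    have "w i \<in> carrier (V i)" using w(1) i by simp
    then obtain \<phi> :: "'u \<Rightarrow> complex" where "\<phi> (w i) = 1"
      "\<And>v w. v \<in> carrier (V i) \<Longrightarrow> w \<in> carrier (V i) \<Longrightarrow> \<phi> (v \<oplus>\<^bsub>V i\<^esub> w) = \<phi> v + \<phi> w"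
      "\<And>c v. v \<in> carrier (V i) \<Longrightarrow> \<phi> (c \<odot>\<^bsub>V i\<^esub> v) = c * \<phi> v"
      using exists_linear_functional[OF _ w(2)[OF i]] by blast
    then show ?thesis by blast
  qed
  then obtain \<phi> :: "'i \<Rightarrow> 'u \<Rightarrow> complex" where \<phi>: "\<And>i. i \<in> I \<Longrightarrow> \<phi> i (w i) = 1"
    "\<And>i x y. i \<in> I \<Longrightarrow> x \<in> carrier (V i) \<Longrightarrow> y \<in> carrier (V i) \<Longrightarrow> \<phi> i (x \<oplus>\<^bsub>V i\<^esub> y) = \<phi> i x + \<phi> i y"
    "\<And>i c x. i \<in> I \<Longrightarrow> x \<in> carrier (V i) \<Longrightarrow> \<phi> i (c \<odot>\<^bsub>V i\<^esub> x) = c * \<phi> i x"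
    by metis
  define \<Phi> where "\<Phi> f = (\<Sum>u\<in>Poly_Mapping.keys f. Poly_Mapping.lookup f u * (\<Prod>i\<in>I. \<phi> i (u i)))" for f
  have \<Phi>_add: "\<Phi> (f + g) = \<Phi> f + \<Phi> g" for f g
    unfolding \<Phi>_def by (rule sum_keys_add) (simp add: distrib_right)
  have \<Phi>_0: "\<Phi> 0 = 0" by (simp add: \<Phi>_def)
  have \<Phi>_single: "\<Phi> (Poly_Mapping.single u c) = c * (\<Prod>i\<in>I. \<phi> i (u i))" for u c
    by (simp add: \<Phi>_def)
  have \<Phi>_scale: "\<Phi> (pm_scale (*) c f) = c * \<Phi> f" for c f
    by (induction f rule: poly_mapping_keys_induct[OF subset_UNIV])
      (simp_all add: \<Phi>_add \<Phi>_0 \<Phi>_single pm.scale_right_distrib distrib_left)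
  have \<Phi>_diff: "\<Phi> (f - g) = \<Phi> f - \<Phi> g" for f g
    using \<Phi>_add[of "f - g" g] by simp
  have upd: "(\<Prod>j\<in>I. \<phi> j ((u(i := x)) j)) = \<phi> i x * (\<Prod>j\<in>I - {i}. \<phi> j (u j))" if "i \<in> I" for u i x
    using that finite_I by (subst prod.remove[of I i]) (auto intro!: prod.cong)
  have "\<Phi> f = 0" if "f \<in> R" for f
    using that
  proof (induction rule: R_induct)
    case subspace
    show ?case by (rule pm.subspaceI) (auto simp: \<Phi>_add \<Phi>_0 \<Phi>_scale)
  next
    case (add u i a b)
    then show ?case unfolding \<Phi>_diff \<Phi>_single by (simp only: upd) (simp add: \<phi> distrib_right)
  next
    case (smult u i c a)
    then show ?case unfolding \<Phi>_diff \<Phi>_single by (simp only: upd) (simp add: \<phi>)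
  qed
  moreover have "\<Phi> (Poly_Mapping.single w 1) = 1" by (simp add: \<Phi>_single \<phi>)
  ultimately show ?thesis by (metis zero_neq_one)
qed

section \<open>The tensor product as a module over the Lie algebra\<close>

abbreviation "free_act x f \<equiv> (\<Sum>i\<in>I. slot i (act (V i) x) f)"

lemma free_act_F: "f \<in> F \<Longrightarrow> free_act x f \<in> F"
  by (intro F_closed slot_F) (auto dest: lie_module.act_closed[OF factor])

lemma free_act_R:
  assumes "f \<in> R"
  shows "free_act x f \<in> R"
proof (intro R_closed slot_R assms)
  fix i assume i: "i \<in> I"
  interpret lie_module scale bracket "V i" using i by (intro factor)
  show "\<And>u. u \<in> carrier (V i) \<Longrightarrow> act (V i) x u \<in> carrier (V i)"
    "\<And>u v. u \<in> carrier (V i) \<Longrightarrow> v \<in> carrier (V i) \<Longrightarrow> act (V i) x (u \<oplus>\<^bsub>V i\<^esub> v) = act (V i) x u \<oplus>\<^bsub>V i\<^esub> act (V i) x v"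
    "\<And>c u. u \<in> carrier (V i) \<Longrightarrow> act (V i) x (c \<odot>\<^bsub>V i\<^esub> u) = c \<odot>\<^bsub>V i\<^esub> act (V i) x u"
    by (auto simp: act_closed act_add_right act_smult_right)
qed

lemma free_act_linear:
  "free_act x (f + g) = free_act x f + free_act x g"
  "free_act x (f - g) = free_act x f - free_act x g"
  "free_act x (pm_scale (*) c f) = pm_scale (*) c (free_act x f)"
  by (simp_all add: slot_add slot_diff slot_scale sum.distrib sum_subtractf pm.scale_sum_right)

lemma free_act_add:
  assumes f: "f \<in> F"
  shows "free_act (x + y) f - (free_act x f + free_act y f) \<in> R"
proof -
  have "slot i (act (V i) (x + y)) f - (slot i (act (V i) x) f + slot i (act (V i) y) f) \<in> R" if i: "i \<in> I" for i
  proof -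
    interpret lie_module scale bracket "V i" using i by (intro factor)
    have "slot i (act (V i) (x + y)) f = slot i (\<lambda>u. act (V i) x u \<oplus>\<^bsub>V i\<^esub> act (V i) y u) f"
      using f i by (intro slot_cong) (auto simp: tensor_space_def subset_iff act_add_left)
    then show ?thesis using slot_add_fun[OF f i, of "act (V i) x" "act (V i) y"] act_closed by simp
  qed
  then have "(\<Sum>i\<in>I. slot i (act (V i) (x + y)) f - (slot i (act (V i) x) f + slot i (act (V i) y) f)) \<in> R"
    by (rule R_closed)
  then show ?thesis by (simp add: sum_subtractf sum.distrib)
qed

lemma free_act_scale:
  assumes f: "f \<in> F"
  shows "free_act (scale c x) f - pm_scale (*) c (free_act x f) \<in> R"
proof -
  have "slot i (act (V i) (scale c x)) f - pm_scale (*) c (slot i (act (V i) x) f) \<in> R" if i: "i \<in> I" for i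
  proof -
    interpret lie_module scale bracket "V i" using i by (intro factor)
    have "slot i (act (V i) (scale c x)) f = slot i (\<lambda>u. c \<odot>\<^bsub>V i\<^esub> act (V i) x u) f"
      using f i by (intro slot_cong) (auto simp: tensor_space_def subset_iff act_scale_left)
    then show ?thesis using slot_smult_fun[OF f i, of "act (V i) x" c] act_closed by simp
  qed
  then have "(\<Sum>i\<in>I. slot i (act (V i) (scale c x)) f - pm_scale (*) c (slot i (act (V i) x) f)) \<in> R"
    by (rule R_closed)
  then show ?thesis by (simp add: sum_subtractf pm.scale_sum_right)
qed

text \<open>
  Operators on different factors commute, so only the diagonal terms of the commutator remain, and
  these are handled by the bracket relation in one factor.
\<close>

lemma free_act_bracket:
  assumes f: "f \<in> F"
  shows "free_act (bracket x y) f - (free_act x (free_act y f) - free_act y (free_act x f)) \<in> R"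
proof -
  let ?X = "\<lambda>i. slot i (act (V i) x)" and ?Y = "\<lambda>i. slot i (act (V i) y)"
  have "free_act x (free_act y f) - free_act y (free_act x f) =
      (\<Sum>i\<in>I. \<Sum>j\<in>I. ?X i (?Y j f)) - (\<Sum>i\<in>I. \<Sum>j\<in>I. ?Y j (?X i f))"
    by (simp add: slot_sum sum.swap[of "\<lambda>i j. ?Y j (?X i f)"])
  also have "\<dots> = (\<Sum>i\<in>I. \<Sum>j\<in>I. ?X i (?Y j f) - ?Y j (?X i f))"
    by (simp add: sum_subtractf)
  also have "\<dots> = (\<Sum>i\<in>I. \<Sum>j\<in>I. if j = i then ?X i (?Y i f) - ?Y i (?X i f) else 0)"
    by (intro sum.cong refl) (auto simp: slot_commute)
  also have "\<dots> = (\<Sum>i\<in>I. ?X i (?Y i f) - ?Y i (?X i f))"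
    using finite_I by (simp add: sum.delta)
  finally have comm: "free_act x (free_act y f) - free_act y (free_act x f) = (\<Sum>i\<in>I. ?X i (?Y i f) - ?Y i (?X i f))" .
  have "slot i (act (V i) (bracket x y)) f - (?X i (?Y i f) - ?Y i (?X i f)) \<in> R" if i: "i \<in> I" for i
  proof -
    interpret lie_module scale bracket "V i" using i by (intro factor)
    have "slot i (act (V i) (bracket x y)) f
        = slot i (\<lambda>u. 1 \<odot>\<^bsub>V i\<^esub> act (V i) x (act (V i) y u) \<oplus>\<^bsub>V i\<^esub> (-1) \<odot>\<^bsub>V i\<^esub> act (V i) y (act (V i) x u)) f"
      using f i by (intro slot_cong)
        (auto simp: tensor_space_def subset_iff act_bracket act_closed a_minus_def smult_minus_one)
    then show ?thesis
      using slot_lincomb[OF f i, of "\<lambda>u. act (V i) x (act (V i) y u)" "\<lambda>u. act (V i) y (act (V i) x u)" 1 "-1"] act_closed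
      by (simp add: slot_compose)
  qed
  then have "(\<Sum>i\<in>I. slot i (act (V i) (bracket x y)) f - (?X i (?Y i f) - ?Y i (?X i f))) \<in> R"
    by (rule R_closed)
  then show ?thesis unfolding comm by (simp add: sum_subtractf)
qed

definition cls :: "(('i \<Rightarrow> 'u) \<Rightarrow>\<^sub>0 complex) \<Rightarrow> (('i \<Rightarrow> 'u) \<Rightarrow>\<^sub>0 complex) set" where
  "cls f = {g. g - f \<in> R}"

lemma coset_eq_cls: "R +>\<^bsub>free_tensor I V\<^esub> f = cls f"
proof -
  have "R +>\<^bsub>free_tensor I V\<^esub> f = (\<lambda>h. h + f) ` R"
    by (auto simp: a_r_coset_def' free_tensor_def)
  also have "\<dots> = cls f"
    by (force simp: cls_def)
  finally show ?thesis .
qed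

lemma cls_eq_iff: "cls f = cls g \<longleftrightarrow> f - g \<in> R"
proof
  assume "cls f = cls g"
  then have "f \<in> cls g" using R_closed(1) by (auto simp: cls_def)
  then show "f - g \<in> R" by (simp add: cls_def)
next
  assume fg: "f - g \<in> R"
  have "h - f \<in> R \<longleftrightarrow> h - g \<in> R" for h
    using R_closed(2)[OF _ fg, of "h - f"] R_closed(4)[OF _ fg, of "h - g"] by (auto simp: algebra_simps)
  then show "cls f = cls g" by (simp add: cls_def)
qed

lemma self_in_cls: "f \<in> cls f"
  by (simp add: cls_def R_closed)

lemma cls_0: "cls 0 = R"
  by (simp add: cls_def)

abbreviation "Q \<equiv> tensor_lie_module I V"

lemma carrier_Q: "carrier Q = cls ` F"
  unfolding tensor_lie_module_def quotient_lie_module_def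
  by (auto simp: A_RCOSETS_def' coset_eq_cls tensor_space_def free_tensor_def[of I V] simp flip: coset_eq_cls)

lemma zero_Q: "\<zero>\<^bsub>Q\<^esub> = cls 0"
  by (simp add: tensor_lie_module_def quotient_lie_module_def cls_0)

lemma add_Q: "cls f \<oplus>\<^bsub>Q\<^esub> cls g = cls (f + g)"
proof -
  have "cls f \<oplus>\<^bsub>Q\<^esub> cls g = {a + b | a b. a \<in> cls f \<and> b \<in> cls g}"
    by (auto simp: tensor_lie_module_def quotient_lie_module_def set_add_def' free_tensor_def)
  also have "\<dots> = cls (f + g)"
  proof (intro equalityI subsetI)
    fix h assume "h \<in> {a + b | a b. a \<in> cls f \<and> b \<in> cls g}"
    then obtain a b where "h = a + b" "a - f \<in> R" "b - g \<in> R" by (auto simp: cls_def)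
    then show "h \<in> cls (f + g)" using R_closed(2)[of "a - f" "b - g"] by (simp add: cls_def algebra_simps)
  next
    fix h assume "h \<in> cls (f + g)"
    then have "h - g \<in> cls f" by (simp add: cls_def algebra_simps)
    then show "h \<in> {a + b | a b. a \<in> cls f \<and> b \<in> cls g}"
      using self_in_cls[of g] by (intro CollectI exI[of _ "h - g"] exI[of _ g]) auto
  qed
  finally show ?thesis .
qed

lemma UN_cls:
  assumes "\<And>h. h \<in> cls f \<Longrightarrow> k h - k f \<in> R"
  shows "(\<Union>h\<in>cls f. cls (k h)) = cls (k f)"
proof -
  have "cls (k h) = cls (k f)" if "h \<in> cls f" for h
    using assms[OF that] cls_eq_iff by simp
  then have "(\<Union>h\<in>cls f. cls (k h)) = (\<Union>h\<in>cls f. cls (k f))" by (intro SUP_cong refl)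
  then show ?thesis using self_in_cls[of f] by (simp add: UN_constant) blast
qed

lemma smult_Q: "c \<odot>\<^bsub>Q\<^esub> cls f = cls (pm_scale (*) c f)"
proof -
  have "c \<odot>\<^bsub>Q\<^esub> cls f = (\<Union>h\<in>cls f. cls (pm_scale (*) c h))"
    by (simp add: tensor_lie_module_def quotient_lie_module_def coset_eq_cls) (simp add: free_tensor_def)
  also have "\<dots> = cls (pm_scale (*) c f)"
    by (rule UN_cls) (use R_closed(3) in \<open>simp add: cls_def flip: pm.scale_right_diff_distrib\<close>)
  finally show ?thesis .
qed

lemma act_Q: "act Q x (cls f) = cls (free_act x f)"
proof -
  have "act Q x (cls f) = (\<Union>h\<in>cls f. cls (free_act x h))"
    by (simp add: tensor_lie_module_def quotient_lie_module_def coset_eq_cls free_tensor_act)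
  also have "\<dots> = cls (free_act x f)"
    by (rule UN_cls) (use free_act_R in \<open>simp add: cls_def flip: free_act_linear\<close>)
  finally show ?thesis .
qed

lemmas Q_simps = carrier_Q zero_Q add_Q smult_Q act_Q

lemma abelian_group_Q: "abelian_group Q"
proof (rule abelian_groupI)
  fix x assume "x \<in> carrier Q"
  then obtain f where f: "f \<in> F" "x = cls f" by (auto simp: Q_simps)
  then have "cls (- f) \<in> carrier Q" "cls (- f) \<oplus>\<^bsub>Q\<^esub> x = \<zero>\<^bsub>Q\<^esub>"
    using F_closed(4)[OF F_closed(1), of f] by (auto simp: Q_simps)
  then show "\<exists>y\<in>carrier Q. y \<oplus>\<^bsub>Q\<^esub> x = \<zero>\<^bsub>Q\<^esub>" by blast
qed (auto simp: Q_simps F_closed ac_simps)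

lemma minus_Q:
  assumes "f \<in> F" "g \<in> F"
  shows "cls f \<ominus>\<^bsub>Q\<^esub> cls g = cls (f - g)"
proof -
  interpret abelian_group Q by (rule abelian_group_Q)
  have "\<ominus>\<^bsub>Q\<^esub> cls g = cls (- g)"
    using F_closed(4)[OF F_closed(1) assms(2)] assms by (intro minus_equality) (auto simp: Q_simps)
  then show ?thesis by (simp add: a_minus_def Q_simps)
qed

lemma lie_module_tensor: "lie_module scale bracket Q"
proof (rule lie_module.intro)
  show "lie_algebra scale bracket" by unfold_locales
  show "Module.module complex_field Q"
    by (rule Module.moduleI[OF cring_from_type_algebra abelian_group_Q])
      (auto simp: Q_simps F_closed pm.scale_right_distrib pm.scale_left_distrib)
  show "lie_module_axioms scale bracket Q"
    by (rule lie_module_axioms.intro)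
      (auto simp: Q_simps free_act_F F_closed free_act_linear minus_Q
        free_act_add[folded cls_eq_iff] free_act_scale[folded cls_eq_iff] free_act_bracket[folded cls_eq_iff])
qed

text \<open>
  Submodules of the quotient correspond to stable subspaces of the free tensor space that contain the
  relations.
\<close>

lemma irreducible_tensorI:
  assumes nonzero: "\<And>i. i \<in> I \<Longrightarrow> carrier (V i) \<noteq> {\<zero>\<^bsub>V i\<^esub>}"
    and irreducible: "\<And>N. pm.subspace N \<Longrightarrow> R \<subseteq> N \<Longrightarrow> N \<subseteq> F \<Longrightarrow>
      (\<And>x f. f \<in> N \<Longrightarrow> free_act x f \<in> N) \<Longrightarrow> N = R \<or> N = F"
  shows "irreducible_lie_module scale bracket Q"
proof (rule irreducible_lie_module.intro[OF lie_module_tensor])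
  show "irreducible_lie_module_axioms Q"
  proof (rule irreducible_lie_module_axioms.intro)
    have "\<exists>x. x \<in> carrier (V i) \<and> x \<noteq> \<zero>\<^bsub>V i\<^esub>" if i: "i \<in> I" for i
    proof -
      interpret lie_module scale bracket "V i" using i by (intro factor)
      show ?thesis using nonzero[OF i] M.zero_closed by blast
    qed
    then obtain w where w: "\<And>i. i \<in> I \<Longrightarrow> w i \<in> carrier (V i)" "\<And>i. i \<in> I \<Longrightarrow> w i \<noteq> \<zero>\<^bsub>V i\<^esub>" by metis
    have "Poly_Mapping.single (restrict w I) 1 \<notin> R"
      by (rule single_notin_R) (use w in auto)
    then have "cls (Poly_Mapping.single (restrict w I) 1) \<noteq> \<zero>\<^bsub>Q\<^esub>"
      by (simp add: Q_simps cls_eq_iff)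
    moreover have "cls (Poly_Mapping.single (restrict w I) 1) \<in> carrier Q"
      unfolding carrier_Q using w by (intro imageI single_in_F) auto
    ultimately show "carrier Q \<noteq> {\<zero>\<^bsub>Q\<^esub>}" by blast
  next
    interpret Q: lie_module scale bracket Q by (rule lie_module_tensor)
    fix N assume N: "lie_submodule N Q"
    then have sub: "submodule N complex_field Q" and stable: "\<And>x u. u \<in> N \<Longrightarrow> act Q x u \<in> N"
      by (auto simp: lie_submodule_def)
    note N_closed = Q.M.submoduleE[OF sub]
    define N' where "N' = {f \<in> F. cls f \<in> N}"
    have N_eq: "N = cls ` N'" using N_closed(1) by (auto simp: N'_def Q_simps)
    have zero: "cls 0 \<in> N"
    proof -
      obtain a where "a \<in> N" using N_closed(2) by blast
      then have "0 \<odot>\<^bsub>Q\<^esub> a \<in> N" "a \<in> carrier Q" using N_closed(1,4) by auto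
      then show ?thesis by (simp add: zero_Q)
    qed
    have smult: "cls (pm_scale (*) c f) \<in> N" if "cls f \<in> N" for c f
      using N_closed(4)[OF _ that, of c] by (simp add: Q_simps)
    have "N' = R \<or> N' = F"
    proof (rule irreducible)
      show "pm.subspace N'"
        by (rule pm.subspaceI) (auto simp: N'_def F_closed zero smult N_closed(5) simp flip: add_Q)
      show "R \<subseteq> N'"
      proof
        fix f assume f: "f \<in> R"
        then have "cls f = cls 0" by (simp add: cls_eq_iff)
        then show "f \<in> N'" using f R_subset_F zero by (auto simp: N'_def)
      qed
      show "free_act x f \<in> N'" if "f \<in> N'" for x f
        using that stable[of "cls f" x] free_act_F by (simp add: N'_def act_Q)
    qed (auto simp: N'_def)
    then show "N = {\<zero>\<^bsub>Q\<^esub>} \<or> N = carrier Q"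
    proof
      assume "N' = R"
      have "cls f = cls 0" if "f \<in> R" for f using that by (simp add: cls_eq_iff)
      with \<open>N' = R\<close> have "N \<subseteq> {cls 0}" using N_eq by auto
      then show ?thesis using zero by (auto simp: zero_Q)
    qed (auto simp: N_eq carrier_Q)
  qed
qed

end

section \<open>Subspaces stable under the separate actions on the factors\<close>

context tensor_family
begin

lemma zero_component_in_R:
  assumes "u \<in> tuples I V" "i \<in> I" "u i = \<zero>\<^bsub>V i\<^esub>"
  shows "Poly_Mapping.single u c \<in> R"
proof -
  interpret lie_module scale bracket "V i" using assms by (intro factor)
  have "u(i := \<zero>\<^bsub>V i\<^esub>) = u" using assms(3) by auto
  then show ?thesis using R_smult[OF assms(1,2), of "\<zero>\<^bsub>V i\<^esub>" 0 c] by simp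
qed

lemma slot_foldr_in_R:
  assumes f: "f \<in> F" and i: "i \<in> I"
    and closed: "\<And>b x. b \<in> set bs \<Longrightarrow> x \<in> carrier (V i) \<Longrightarrow> b x \<in> carrier (V i)"
    and R: "\<And>b. b \<in> set bs \<Longrightarrow> slot i b f \<in> R"
  shows "slot i (\<lambda>x. foldr (\<lambda>b y. b x \<oplus>\<^bsub>V i\<^esub> y) bs \<zero>\<^bsub>V i\<^esub>) f \<in> R"
  using closed R
proof (induction bs)
  case Nil
  interpret lie_module scale bracket "V i" using i by (intro factor)
  show ?case using slot_smult_fun[OF f i, of "\<lambda>x. \<zero>\<^bsub>V i\<^esub>" 0] by simp
next
  case (Cons b bs)
  interpret lie_module scale bracket "V i" using i by (intro factor)
  let ?g = "\<lambda>x. foldr (\<lambda>b y. b x \<oplus>\<^bsub>V i\<^esub> y) bs \<zero>\<^bsub>V i\<^esub>"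
  have g: "?g x \<in> carrier (V i)" if "x \<in> carrier (V i)" for x
    using Cons.prems(1) that by (induction bs) auto
  have "slot i (\<lambda>x. b x \<oplus>\<^bsub>V i\<^esub> ?g x) f - (slot i b f + slot i ?g f) \<in> R"
    by (rule slot_add_fun[OF f i]) (use Cons.prems(1) g in auto)
  moreover have "slot i b f + slot i ?g f \<in> R"
    using Cons by (intro R_closed) auto
  ultimately have "slot i (\<lambda>x. b x \<oplus>\<^bsub>V i\<^esub> ?g x) f - (slot i b f + slot i ?g f) + (slot i b f + slot i ?g f) \<in> R"
    by (rule R_closed(2))
  then show ?case by simp
qed

text \<open>
  The sets \<open>A i\<close> stand for the enveloping algebra acting on the factor \<open>i\<close>. The first induction uses rank-one
  decompositions to make the entries of an element outside \<open>R\<close> constant on more and more factors, until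
  it is a multiple of a single tuple; the second one replaces the components of this tuple one by one.
\<close>

lemma slot_stable_subspace_trivial:
  assumes N: "pm.subspace N" "R \<subseteq> N" "N \<subseteq> F"
    and closed: "\<And>i b x. i \<in> I \<Longrightarrow> b \<in> A i \<Longrightarrow> x \<in> carrier (V i) \<Longrightarrow> b x \<in> carrier (V i)"
    and stable: "\<And>i b f. i \<in> I \<Longrightarrow> b \<in> A i \<Longrightarrow> f \<in> N \<Longrightarrow> slot i b f \<in> N"
    and rank_one: "\<And>i S. i \<in> I \<Longrightarrow> finite S \<Longrightarrow> S \<subseteq> carrier (V i) \<Longrightarrow> \<exists>bs. set bs \<subseteq> A i
      \<and> (\<forall>b\<in>set bs. \<exists>e\<in>carrier (V i). \<forall>x\<in>S. \<exists>c. b x = c \<odot>\<^bsub>V i\<^esub> e)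
      \<and> (\<forall>x\<in>S. foldr (\<lambda>b y. b x \<oplus>\<^bsub>V i\<^esub> y) bs \<zero>\<^bsub>V i\<^esub> = x)"
    and transitive: "\<And>i x y. i \<in> I \<Longrightarrow> x \<in> carrier (V i) \<Longrightarrow> y \<in> carrier (V i) \<Longrightarrow> x \<noteq> \<zero>\<^bsub>V i\<^esub> \<Longrightarrow>
      \<exists>b\<in>A i. b x = y"
  shows "N = R \<or> N = F"
proof (rule disjCI)
  assume "N \<noteq> F"
  show "N = R"
  proof (rule ccontr)
    assume "N \<noteq> R"
    then obtain f0 where f0: "f0 \<in> N" "f0 \<notin> R" using N(2) by blast
    have "\<exists>f e. f \<in> N \<and> f \<notin> R \<and> (\<forall>i\<in>K. \<forall>u\<in>Poly_Mapping.keys f. u i = e i)" if "K \<subseteq> I" for K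
      using finite_subset[OF that finite_I] that
    proof (induction K)
      case empty
      then show ?case using f0 by auto
    next
      case (insert i K)
      then obtain f e where f: "f \<in> N" "f \<notin> R" "\<forall>j\<in>K. \<forall>u\<in>Poly_Mapping.keys f. u j = e j"
        by auto
      have i: "i \<in> I" using insert by simp
      have fF: "f \<in> F" using f N(3) by auto
      have keys: "u \<in> tuples I V" if "u \<in> Poly_Mapping.keys f" for u
        using fF that unfolding tensor_space_def by auto
      define S where "S = (\<lambda>u. u i) ` Poly_Mapping.keys f"
      have S: "finite S" "S \<subseteq> carrier (V i)" using keys i by (auto simp: S_def)
      obtain bs where bs: "set bs \<subseteq> A i" "\<And>b. b \<in> set bs \<Longrightarrow> \<exists>e\<in>carrier (V i). \<forall>x\<in>S. \<exists>c. b x = c \<odot>\<^bsub>V i\<^esub> e"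
        "\<And>x. x \<in> S \<Longrightarrow> foldr (\<lambda>b y. b x \<oplus>\<^bsub>V i\<^esub> y) bs \<zero>\<^bsub>V i\<^esub> = x"
        using rank_one[OF i S] by blast
      \<comment> \<open>On the entries of \<open>f\<close> in the factor \<open>i\<close> the operators in \<open>bs\<close> add up to the identity,
        so they cannot all send \<open>f\<close> into the relations.\<close>
      have "\<exists>b\<in>set bs. slot i b f \<notin> R"
      proof (rule ccontr)
        assume "\<not> (\<exists>b\<in>set bs. slot i b f \<notin> R)"
        then have "slot i (\<lambda>x. foldr (\<lambda>b y. b x \<oplus>\<^bsub>V i\<^esub> y) bs \<zero>\<^bsub>V i\<^esub>) f \<in> R"
          using bs(1) closed[OF i] by (intro slot_foldr_in_R fF i) auto
        also have "slot i (\<lambda>x. foldr (\<lambda>b y. b x \<oplus>\<^bsub>V i\<^esub> y) bs \<zero>\<^bsub>V i\<^esub>) f = slot i (\<lambda>x. x) f"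
          by (rule slot_cong) (auto simp: bs(3) S_def)
        finally show False using f by simp
      qed
      then obtain b where b: "b \<in> set bs" "slot i b f \<notin> R" by blast
      then obtain e' where e': "e' \<in> carrier (V i)" "\<And>x. x \<in> S \<Longrightarrow> \<exists>c. b x = c \<odot>\<^bsub>V i\<^esub> e'"
        using bs(2) by blast
      then obtain c where c: "\<And>x. x \<in> S \<Longrightarrow> b x = c x \<odot>\<^bsub>V i\<^esub> e'" by metis
      \<comment> \<open>Pulling the scalars out of the factor \<open>i\<close> changes \<open>slot i b f\<close> only by relations and leaves
        the same entry \<open>e'\<close> everywhere in this factor.\<close>
      define g where "g = (\<Sum>u\<in>Poly_Mapping.keys f. Poly_Mapping.single (u(i := e')) (c (u i) * Poly_Mapping.lookup f u))"
      have "slot i b f - g = (\<Sum>u\<in>Poly_Mapping.keys f. Poly_Mapping.single (u(i := c (u i) \<odot>\<^bsub>V i\<^esub> e')) (Poly_Mapping.lookup f u)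
          - Poly_Mapping.single (u(i := e')) (c (u i) * Poly_Mapping.lookup f u))"
        by (simp add: slot_def g_def sum_subtractf S_def c cong: sum.cong)
      also have "\<dots> \<in> R" using keys i e' by (intro R_closed R_smult) auto
      finally have g: "slot i b f - g \<in> R" .
      have "slot i b f \<in> N" using stable i bs(1) b f by auto
      then have "slot i b f - (slot i b f - g) \<in> N"
        by (rule pm.subspace_diff[OF N(1)]) (use g N(2) in blast)
      then have "g \<in> N" by simp
      moreover have "g \<notin> R"
        using R_closed(2)[OF g, of g] b by auto
      moreover have "\<forall>j\<in>insert i K. \<forall>u\<in>Poly_Mapping.keys g. u j = (e(i := e')) j"
      proof -
        have "Poly_Mapping.keys g \<subseteq> (\<lambda>u. u(i := e')) ` Poly_Mapping.keys f"
          unfolding g_def by (rule order_trans[OF keys_sum]) (auto split: if_splits)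
        then show ?thesis using f(3) by fastforce
      qed
      ultimately show ?case by blast
    qed
    from this[of I] obtain f e where f: "f \<in> N" "f \<notin> R" "\<forall>i\<in>I. \<forall>u\<in>Poly_Mapping.keys f. u i = e i"
      by auto
    have keys: "u \<in> tuples I V" if "u \<in> Poly_Mapping.keys f" for u
      using f(1) N(3) that unfolding tensor_space_def by auto
    \<comment> \<open>All tuples that occur in \<open>f\<close> agree on \<open>I\<close>, so there is only one.\<close>
    obtain w where w: "w \<in> Poly_Mapping.keys f"
    proof -
      have "f \<noteq> 0" using f(2) R_closed(1) by auto
      then show ?thesis using that by (metis all_not_in_conv keys_eq_empty)
    qed
    have "u = w" if "u \<in> Poly_Mapping.keys f" for u
      by (rule PiE_ext[OF keys[OF that] keys[OF w]]) (simp add: f(3) that w)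
    then have f_eq: "f = Poly_Mapping.single w (Poly_Mapping.lookup f w)"
      by (intro poly_mapping_eqI) (auto simp: lookup_single when_def in_keys_iff)
    define d where "d = Poly_Mapping.lookup f w"
    have d: "d \<noteq> 0" "f = Poly_Mapping.single w d" using w f_eq by (auto simp: d_def in_keys_iff)
    have w1: "Poly_Mapping.single w 1 \<in> N" 
      using pm.subspace_scale[OF N(1) f(1), of "1 / d"] d by simp
    have wt: "w \<in> tuples I V" using keys w by simp
    have w0: "w i \<noteq> \<zero>\<^bsub>V i\<^esub>" if "i \<in> I" for i
      using zero_component_in_R[OF wt that] f(2) d by auto
    have "Poly_Mapping.single (override_on w v K) 1 \<in> N" if v: "v \<in> tuples I V" and "K \<subseteq> I" for v K
      using finite_subset[OF \<open>K \<subseteq> I\<close> finite_I] \<open>K \<subseteq> I\<close>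
    proof (induction K)
      case empty
      then show ?case using w1 by simp
    next
      case (insert i K)
      then have i: "i \<in> I" by simp
      obtain b where b: "b \<in> A i" "b (w i) = v i"
        using transitive[OF i tuples_component[OF wt i] tuples_component[OF v i] w0[OF i]] by blast
      have "slot i b (Poly_Mapping.single (override_on w v K) 1) \<in> N"
        using insert b i by (intro stable) auto
      moreover have "(override_on w v K)(i := v i) = override_on w v (insert i K)"
        by (auto simp: override_on_def)
      ultimately show ?case using insert b by simp
    qed
    moreover have "override_on w v I = v" if "v \<in> tuples I V" for v
      using that wt by (auto simp: override_on_def fun_eq_iff PiE_iff extensional_def)
    ultimately have pure: "Poly_Mapping.single v 1 \<in> N" if "v \<in> tuples I V" for v
      using that by (metis order_refl)
    have "h \<in> N" if "h \<in> F" for h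
      using that
    proof (induction rule: F_induct)
      case zero
      show ?case by (rule pm.subspace_0[OF N(1)])
    next
      case (add h u c)
      show ?case
        using pm.subspace_add[OF N(1) add(3) pm.subspace_scale[OF N(1) pure[OF add(1)], of c]] by simp
    qed
    then show False using N(3) \<open>N \<noteq> F\<close> by auto
  qed
qed

end

section \<open>Evaluation at distinct points\<close>

context lie_module
begin

lemma ev_laurent_polynomial:
  assumes u: "u \<in> carrier M"
  shows "ev z (\<Sum>n\<le>degree q. loop (scale (coeff q n) x) (int n)) u = poly q z \<odot> act M x u"
proof -
  have "ev z (\<Sum>n\<in>A. loop (scale (coeff q n) x) (int n)) u = (\<Sum>n\<in>A. coeff q n * z ^ n) \<odot> act M x u" if "finite A" for A
    using that
  proof induction
    case empty
    then show ?case using u ev_central[of z 0 u] by (simp add: zero_prod_def act_closed)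
  next
    case (insert n A)
    then show ?case
      using u by (simp add: ev_add_left evaluation_loop act_scale_left act_closed smult_smult smult_add_left mult.commute)
  qed
  then show ?thesis by (simp add: poly_altdef)
qed

end

lemma lagrange_polynomial:
  fixes z :: "'i \<Rightarrow> complex"
  assumes "finite I" "inj_on z I" "i \<in> I"
  obtains q where "\<And>j. j \<in> I \<Longrightarrow> poly q (z j) = (if j = i then 1 else 0)"
proof -
  define p where "p = (\<Prod>j\<in>I - {i}. [:- z j, 1:])"
  have "poly p (z i) \<noteq> 0"
    using assms by (auto simp: p_def poly_prod inj_on_def)
  moreover have "poly p (z j) = 0" if "j \<in> I" "j \<noteq> i" for j
    using that assms(1) by (auto simp: p_def poly_prod prod_zero_iff)
  ultimately show ?thesis
    by (intro that[of "smult (1 / poly p (z i)) p"]) auto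
qed

text \<open>
  A subspace of the free tensor space that is stable under the affine Lie algebra is stable under
  the original one on each factor, by interpolation; this extends to the enveloping algebras, so that
  density applies.
\<close>

lemma irreducible_tensor_of_evaluations:
  fixes scale :: "complex \<Rightarrow> 'g::ab_group_add \<Rightarrow> 'g"
    and U :: "'i \<Rightarrow> ('g, 'u) lie_module" and z :: "'i \<Rightarrow> complex"
  assumes finite: "finite I" and form: "lie_algebra_form scale bracket form"
    and countable: "countable_dimension scale"
    and irred: "\<And>i. i \<in> I \<Longrightarrow> irreducible_lie_module scale bracket (U i)"
    and inj: "inj_on z I" and nonzero: "\<And>i. i \<in> I \<Longrightarrow> z i \<noteq> 0"
  shows "irreducible_lie_module (affine_scale scale) (affine_bracket bracket form)
           (tensor_lie_module I (\<lambda>i. evaluation_module (U i) (z i)))"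
proof -
  interpret g: lie_algebra_form scale bracket form by (fact form)
  have U: "lie_module scale bracket (U i)" if "i \<in> I" for i
    using irred[OF that] by (simp add: irreducible_lie_module_def)
  interpret T: tensor_family "affine_scale scale" "affine_bracket bracket form" "I"
    "\<lambda>i. evaluation_module (U i) (z i)"
    by (intro tensor_family.intro tensor_family_axioms.intro g.lie_algebra_affine
        lie_module.lie_module_evaluation[OF U form] nonzero finite)
  show ?thesis
  proof (rule T.irreducible_tensorI)
    show "carrier (evaluation_module (U i) (z i)) \<noteq> {\<zero>\<^bsub>evaluation_module (U i) (z i)\<^esub>}"
      if "i \<in> I" for i
      using irreducible_lie_module.nonzero[OF irred[OF that]] by simp
    fix N assume N: "pm.subspace N" "T.R \<subseteq> N" "N \<subseteq> T.F"
      and N_act: "\<And>x f. f \<in> N \<Longrightarrow> T.free_act x f \<in> N"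
    have separate: "slot i (act (U i) x) f \<in> N" if i: "i \<in> I" and f: "f \<in> N" for i x f
    proof -
      have fF: "f \<in> T.F" using f N(3) by auto
      obtain q where q: "\<And>j. j \<in> I \<Longrightarrow> poly q (z j) = (if j = i then 1 else 0)"
        using lagrange_polynomial[OF finite inj i] by blast
      define y where "y = (\<Sum>n\<le>degree q. loop (scale (coeff q n) x) (int n))"
      have "slot j (act (evaluation_module (U j) (z j)) y) f
          - (if j = i then slot i (act (U i) x) f else 0) \<in> T.R" if j: "j \<in> I" for j
      proof -
        interpret lie_module scale bracket "U j" by (rule U[OF j])
        have carrier: "u j \<in> carrier (U j)" if "u \<in> Poly_Mapping.keys f" for u
          using fF that T.tuples_component[OF _ j, of u] by (simp add: T.tensor_space_def subset_iff)
        have "slot j (act (evaluation_module (U j) (z j)) y) f = slot j (\<lambda>u. poly q (z j) \<odot>\<^bsub>U j\<^esub> act (U j) x u) f"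
          unfolding y_def
          by (rule slot_cong, rule ev_laurent_polynomial, rule carrier)
        moreover have "slot j (\<lambda>u. poly q (z j) \<odot>\<^bsub>U j\<^esub> act (U j) x u) f - pm_scale (*) (poly q (z j)) (slot j (act (U j) x) f) \<in> T.R"
          using T.slot_smult_fun[OF fF j, of "act (U j) x" "poly q (z j)"] act_closed by simp
        ultimately show ?thesis using q[OF j] by (auto split: if_splits)
      qed
      then have "(\<Sum>j\<in>I. slot j (act (evaluation_module (U j) (z j)) y) f
          - (if j = i then slot i (act (U i) x) f else 0)) \<in> T.R"
        by (rule T.R_closed)
      then have "T.free_act y f - slot i (act (U i) x) f \<in> N"
        using i N(2) finite by (auto simp: sum_subtractf)
      then have "T.free_act y f - (T.free_act y f - slot i (act (U i) x) f) \<in> N"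
        by (rule pm.subspace_diff[OF N(1) N_act[OF f]])
      then show ?thesis by simp
    qed
    have stable: "slot i b f \<in> N" if i: "i \<in> I" and b: "b \<in> enveloping (U i)" and f: "f \<in> N" for i b f
      using b f
    proof (induction arbitrary: f)
      case (gen x)
      then show ?case by (rule separate[OF i])
    next
      case ident
      then show ?case by simp
    next
      case (comp a b)
      then show ?case by (simp flip: slot_compose)
    next
      case (lincomb a b c d)
      interpret lie_module scale bracket "U i" by (rule U[OF i])
      have fF: "f \<in> T.F" using lincomb.prems N(3) by auto
      have "slot i (\<lambda>x. c \<odot>\<^bsub>U i\<^esub> a x \<oplus>\<^bsub>U i\<^esub> d \<odot>\<^bsub>U i\<^esub> b x) f
          - (pm_scale (*) c (slot i a f) + pm_scale (*) d (slot i b f)) \<in> N"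
        using T.slot_lincomb[OF fF i, of a b c d] enveloping_linear(1) lincomb.hyps N(2) by auto
      moreover have "pm_scale (*) c (slot i a f) + pm_scale (*) d (slot i b f) \<in> N"
        using lincomb by (intro pm.subspace_add[OF N(1)] pm.subspace_scale[OF N(1)]) auto
      ultimately have "slot i (\<lambda>x. c \<odot>\<^bsub>U i\<^esub> a x \<oplus>\<^bsub>U i\<^esub> d \<odot>\<^bsub>U i\<^esub> b x) f
          - (pm_scale (*) c (slot i a f) + pm_scale (*) d (slot i b f))
          + (pm_scale (*) c (slot i a f) + pm_scale (*) d (slot i b f)) \<in> N"
        by (rule pm.subspace_add[OF N(1)])
      then show ?case by simp
    qed
    show "N = T.R \<or> N = T.F"
    proof (rule T.slot_stable_subspace_trivial[OF N, where A = "\<lambda>i. enveloping (U i)"])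
      fix i assume i: "i \<in> I"
      interpret irreducible_lie_module scale bracket "U i" by (rule irred[OF i])
      note density = enveloping_rank_one_and_transitive[OF countable]
      show "b x \<in> carrier (evaluation_module (U i) (z i))"
        if "b \<in> enveloping (U i)" "x \<in> carrier (evaluation_module (U i) (z i))" for b x
        using that enveloping_linear(1) by simp
      show "slot i b f \<in> N" if "b \<in> enveloping (U i)" "f \<in> N" for b f
        using stable i that .
      show "\<exists>bs. set bs \<subseteq> enveloping (U i)
          \<and> (\<forall>b\<in>set bs. \<exists>e\<in>carrier (evaluation_module (U i) (z i)). \<forall>x\<in>S. \<exists>c. b x = c \<odot>\<^bsub>evaluation_module (U i) (z i)\<^esub> e)
          \<and> (\<forall>x\<in>S. foldr (\<lambda>b y. b x \<oplus>\<^bsub>evaluation_module (U i) (z i)\<^esub> y) bs \<zero>\<^bsub>evaluation_module (U i) (z i)\<^esub> = x)"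
        if "finite S" "S \<subseteq> carrier (evaluation_module (U i) (z i))" for S
        using density that by simp
      show "\<exists>b\<in>enveloping (U i). b x = y"
        if "x \<in> carrier (evaluation_module (U i) (z i))" "y \<in> carrier (evaluation_module (U i) (z i))"
          "x \<noteq> \<zero>\<^bsub>evaluation_module (U i) (z i)\<^esub>" for x y
        using density that by simp
    qed
  qed
qed

theorem proposition2p11:
  fixes scale :: "complex \<Rightarrow> 'g::ab_group_add \<Rightarrow> 'g"
    and bracket :: "'g \<Rightarrow> 'g \<Rightarrow> 'g"
    and form :: "'g \<Rightarrow> 'g \<Rightarrow> complex"
    and r :: nat
    and U :: "nat \<Rightarrow> ('g, 'u) lie_module"
    and z :: "nat \<Rightarrow> complex"
  assumes "lie_algebra_form scale bracket form"
    and "countable_dimension scale"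
    and "\<And>i. i \<in> {1..r} \<Longrightarrow> irreducible_lie_module scale bracket (U i)"
    and "inj_on z {1..r}"
    and "\<And>i. i \<in> {1..r} \<Longrightarrow> z i \<noteq> 0"
  shows "irreducible_lie_module (affine_scale scale) (affine_bracket bracket form)
           (tensor_lie_module {1..r} (\<lambda>i. evaluation_module (U i) (z i)))"
  by (rule irreducible_tensor_of_evaluations) (use assms in auto)

end
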